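(* Let $Q = C^\top C$, $R = D^\top D$ and $C^\top D = 0$, and let $x_0 \in \mathbb{R}^n$ and $\gamma > 0$. Let $Z_- := CX_- + DU_-$. The data $(U_-,X)$ are informative for suboptimal linear quadratic regulation if and only if there exist $Y = Y^\top \in \mathbb{R}^{n \times n}$ and $\Theta \in \mathbb{R}^{T \times n}$ such that $$\begin{bmatrix} Y & \Theta^\top X_+^\top & \Theta^\top Z_-^\top \\ X_+ \Theta & Y & 0 \\ Z_-\Theta & 0 & I \end{bmatrix} > 0, \qquad \begin{bmatrix} \gamma & x_0^\top \\ x_0 & Y \end{bmatrix} > 0, \qquad X_-\Theta = Y. \qquad ( * )$$ Moreover, a matrix $K\in\mathbb{R}^{m\times n}$ is a suboptimal feedback gain for all $(A,B) \in \Sigma_{\mathrm{i/s}}$ if and only if $K = U_- \Theta Y^{-1}$ for some $Y=Y^\top$ and $\Theta$ satisfying $( * )$.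
   Context: All matrices are real. For symmetric matrices, $M>0$ ($M\ge 0$) means positive definite (positive semidefinite). A square matrix is stable if all its eigenvalues lie in the open unit disk. Data. There is a fixed unknown system $x(t+1) = A_s x(t) + B_s u(t)$ with $A_s\in\mathbb{R}^{n\times n}$, $B_s\in\mathbb{R}^{n\times m}$. From it one has measured $U_- = [u(0)\ u(1)\ \cdots\ u(T-1)]\in\mathbb{R}^{m\times T}$ and $X=[x(0)\ x(1)\ \cdots\ x(T)]\in\mathbb{R}^{n\times (T+1)}$, and one sets $X_- = [x(0)\ \cdots\ x(T-1)]$, $X_+ = [x(1)\ \cdots\ x(T)]$. Thus $X_+ = A_sX_- + B_sU_-$. The set of systems explaining the data is $$\Sigma_{\mathrm{i/s}} = \{(A,B)\in\mathbb{R}^{n\times n}\times\mathbb{R}^{n\times m} \mid X_+ = AX_- + BU_-\}.$$ Cost. Given are $Q=Q^\top\ge 0$ in $\mathbb{R}^{n\times n}$ and $R=R^\top>0$ in $\mathbb{R}^{m\times m}$; $C\in\mathbb{R}^{p\times n}$ and $D\in\mathbb{R}^{p\times m}$ are matrices factoring them as in the claim. For a system $(A,B)$, initial state $x_0$ (not necessarily equal to the first sample $x(0)$ of the data) and gain $K$, let $J(x_0,K)=\sum_{t=0}^\infty \left(x(t)^\top Q x(t) + u(t)^\top R u(t)\right)$, where $x(\cdot)$ here denotes the closed-loop trajectory $x(t+1)=(A+BK)x(t)$ starting at $x_0$ and $u(t)=Kx(t)$. Given $x_0$ and $\gamma>0$, $K\in\mathbb{R}^{m\times n}$ is a suboptimal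 feedback gain for $(A,B)$ if $A+BK$ is stable and $J(x_0,K)<\gamma$. Informativity. The data $(U_-,X)$ are informative for suboptimal linear quadratic regulation (for given $x_0,\gamma$) if there exists a single matrix $K$ that is a suboptimal feedback gain for all $(A,B)\in\Sigma_{\mathrm{i/s}}$. *)

theory Defs
  imports
    "Jordan_Normal_Form.Char_Poly"
    "Jordan_Normal_Form.Gauss_Jordan_Elimination"
    "HOL-Library.Extended_Real"
begin

definition pos_def_mat :: "real mat \<Rightarrow> bool" where
  "pos_def_mat M \<longleftrightarrow> square_mat M \<and> transpose_mat M = M \<and>
     (\<forall>v \<in> carrier_vec (dim_row M). v \<noteq> 0\<^sub>v (dim_row M) \<longrightarrow> v \<bullet> (M *\<^sub>v v) > 0)"

definition pos_semidef_mat :: "real mat \<Rightarrow> bool" where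
  "pos_semidef_mat M \<longleftrightarrow> square_mat M \<and> transpose_mat M = M \<and>
     (\<forall>v \<in> carrier_vec (dim_row M). v \<bullet> (M *\<^sub>v v) \<ge> 0)"

(* The eigenvalues of a real matrix are its complex ones, hence the embedding. *)
definition stable_mat :: "real mat \<Rightarrow> bool" where
  "stable_mat M \<longleftrightarrow> square_mat M \<and>
     (\<forall>z. eigenvalue (map_mat complex_of_real M) z \<longrightarrow> cmod z < 1)"

definition minus_part :: "real mat \<Rightarrow> real mat" where
  "minus_part X = mat (dim_row X) (dim_col X - 1) (\<lambda>(i, t). X $$ (i, t))"

definition plus_part :: "real mat \<Rightarrow> real mat" where
  "plus_part X = mat (dim_row X) (dim_col X - 1) (\<lambda>(i, t). X $$ (i, t + 1))"

definition explaining_systems :: "real mat \<Rightarrow> real mat \<Rightarrow> (real mat \<times> real mat) set" where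
  "explaining_systems U X =
     {(A, B). A \<in> carrier_mat (dim_row X) (dim_row X) \<and> B \<in> carrier_mat (dim_row X) (dim_row U) \<and>
              plus_part X = A * minus_part X + B * U}"

primrec trajectory :: "real mat \<Rightarrow> real vec \<Rightarrow> nat \<Rightarrow> real vec" where
  "trajectory M x0 0 = x0"
| "trajectory M x0 (Suc t) = M *\<^sub>v trajectory M x0 t"

(* For Q \<ge> 0 and R > 0 all summands are nonnegative, so the sum always exists in ereal;
   a divergent cost is \<infinity>. *)
definition lq_cost ::
  "real mat \<Rightarrow> real mat \<Rightarrow> real mat \<Rightarrow> real mat \<Rightarrow> real vec \<Rightarrow> real mat \<Rightarrow> ereal" where
  "lq_cost Q R A B x0 K =
     (\<Sum>t. ereal (let x = trajectory (A + B * K) x0 t; u = K *\<^sub>v x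
                  in x \<bullet> (Q *\<^sub>v x) + u \<bullet> (R *\<^sub>v u)))"

definition suboptimal_gain ::
  "real mat \<Rightarrow> real mat \<Rightarrow> real vec \<Rightarrow> real \<Rightarrow> real mat \<Rightarrow> real mat \<Rightarrow> real mat \<Rightarrow> bool" where
  "suboptimal_gain Q R x0 \<gamma> A B K \<longleftrightarrow>
     K \<in> carrier_mat (dim_col B) (dim_row A) \<and>
     stable_mat (A + B * K) \<and> lq_cost Q R A B x0 K < ereal \<gamma>"

definition informative_suboptimal_lqr ::
  "real mat \<Rightarrow> real mat \<Rightarrow> real mat \<Rightarrow> real mat \<Rightarrow> real vec \<Rightarrow> real \<Rightarrow> bool" where
  "informative_suboptimal_lqr U X Q R x0 \<gamma> \<longleftrightarrow>
     (\<exists>K \<in> carrier_mat (dim_row U) (dim_row X).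
        \<forall>(A, B) \<in> explaining_systems U X. suboptimal_gain Q R x0 \<gamma> A B K)"

(* The 3 x 3 block matrix is nested as [Y, [P, S]; [P^T; S^T], diag(Y, I)] with
   P = \<Theta>^T X_+^T and S = \<Theta>^T Z_-^T; the library has append_rows but no append_cols, so the
   block row [P, S] is the four_block_mat with two empty bottom blocks. *)
definition lqr_lmi ::
  "real mat \<Rightarrow> real mat \<Rightarrow> real mat \<Rightarrow> real mat \<Rightarrow> real vec \<Rightarrow> real \<Rightarrow> real mat \<Rightarrow> real mat \<Rightarrow> bool" where
  "lqr_lmi U X C D x0 \<gamma> Y \<Theta> \<longleftrightarrow>
     (let n = dim_row X; p = dim_row C; Xm = minus_part X; Xp = plus_part X; Zm = C * Xm + D * U
      in Y \<in> carrier_mat n n \<and> transpose_mat Y = Y \<and> \<Theta> \<in> carrier_mat (dim_col U) n \<and>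
         pos_def_mat
           (four_block_mat
              Y
              (four_block_mat (transpose_mat \<Theta> * transpose_mat Xp) (transpose_mat \<Theta> * transpose_mat Zm)
                              (0\<^sub>m 0 n)                              (0\<^sub>m 0 p))
              (Xp * \<Theta> @\<^sub>r Zm * \<Theta>)
              (four_block_mat Y         (0\<^sub>m n p)
                              (0\<^sub>m p n) (1\<^sub>m p))) \<and>
         pos_def_mat
           (four_block_mat (mat 1 1 (\<lambda>_. \<gamma>))   (mat_of_rows n [x0])
                           (mat_of_cols n [x0]) Y) \<and>
         Xm * \<Theta> = Y)"

end

theory Submission
  imports Defs "Jordan_Normal_Form.Spectral_Radius"
begin

text \<open>
  Write \<open>M = A + B K\<close>, \<open>N = C + D K\<close> and \<open>P = Y\<^sup>-\<^sup>1\<close>. Since \<open>C\<^sup>T D = 0\<close>, the cost is the energy of the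
  output \<open>N x\<close>. If \<open>X\<^sub>- \<Theta> = Y\<close> and \<open>U \<Theta> = K Y\<close>, then \<open>X\<^sub>+ \<Theta> = M Y\<close> and \<open>Z\<^sub>- \<Theta> = N Y\<close> for every explaining
  system, and completing squares turns the linear matrix inequalities into
  \<open>P > M\<^sup>T P M + N\<^sup>T N\<close> and \<open>x\<^sub>0\<^sup>T P x\<^sub>0 < \<gamma>\<close>, which bound the cost by a Lyapunov argument.
  Conversely, if \<open>K\<close> stabilizes all explaining systems, then every \<open>(A\<^sub>0, B\<^sub>0)\<close> with
  \<open>A\<^sub>0 X\<^sub>- + B\<^sub>0 U = 0\<close> satisfies \<open>A\<^sub>0 + B\<^sub>0 K = 0\<close>: otherwise a left multiple \<open>L (A\<^sub>0, B\<^sub>0)\<close>, which still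
  leaves the data invariant, moves an eigenvalue of the closed loop to 2. By linear duality there
  is \<open>\<Gamma>\<close> with \<open>X\<^sub>- \<Gamma> = I\<close> and \<open>U \<Gamma> = K\<close>, so all closed loops coincide with one stable \<open>M\<close>, and
  \<open>P = \<Sum>\<^sub>k (M\<^sup>k)\<^sup>T (N\<^sup>T N + \<epsilon> I) M\<^sup>k\<close> with small \<open>\<epsilon> > 0\<close> yields \<open>Y = P\<^sup>-\<^sup>1\<close> and \<open>\<Theta> = \<Gamma> Y\<close>.
\<close>

section \<open>Quadratic forms and positive definite matrices\<close>

lemma mult_mat_zero_vec:
  fixes A :: "'a :: semiring_0 mat"
  assumes "A \<in> carrier_mat nr nc"
  shows "A *\<^sub>v 0\<^sub>v nc = 0\<^sub>v nr"
  using assms by (intro eq_vecI) auto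

lemma symmetric_scalar_prod:
  fixes P :: "real mat"
  assumes "P \<in> carrier_mat n n" "transpose_mat P = P" "a \<in> carrier_vec n" "b \<in> carrier_vec n"
  shows "a \<bullet> (P *\<^sub>v b) = b \<bullet> (P *\<^sub>v a)"
  using transpose_vec_mult_scalar[of P n n b a] assms
  by (metis comm_scalar_prod mult_mat_vec_carrier)

lemma quadratic_form_add:
  fixes P :: "real mat"
  assumes "P \<in> carrier_mat n n" "transpose_mat P = P" "a \<in> carrier_vec n" "b \<in> carrier_vec n"
  shows "(a + b) \<bullet> (P *\<^sub>v (a + b)) = a \<bullet> (P *\<^sub>v a) + 2 * (a \<bullet> (P *\<^sub>v b)) + b \<bullet> (P *\<^sub>v b)"
proof -
  have [simp]: "P *\<^sub>v a \<in> carrier_vec n" "P *\<^sub>v b \<in> carrier_vec n"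
    using assms by auto
  show ?thesis
    using symmetric_scalar_prod[OF assms(1,2,4,3)] assms
    by (simp add: mult_add_distrib_mat_vec[of _ n n] add_scalar_prod_distrib[of _ n]
        scalar_prod_add_distrib[of _ n])
qed

lemma scalar_prod_self_nonneg: "(v :: real vec) \<bullet> v \<ge> 0"
  unfolding scalar_prod_def by (rule sum_nonneg) auto

lemma scalar_prod_self_pos:
  fixes v :: "real vec"
  assumes "v \<in> carrier_vec n" "v \<noteq> 0\<^sub>v n"
  shows "v \<bullet> v > 0"
proof -
  have "v \<bullet> v \<noteq> 0"
  proof
    assume "v \<bullet> v = 0"
    then have "\<forall>i\<in>{0..<dim_vec v}. v $ i * v $ i = 0"
      unfolding scalar_prod_def by (subst (asm) sum_nonneg_eq_0_iff) auto
    then have "v = 0\<^sub>v n" using assms(1) by (intro eq_vecI) auto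
    with assms(2) show False by simp
  qed
  with scalar_prod_self_nonneg[of v] show ?thesis by simp
qed

lemma pos_def_mat_iff:
  assumes "Y \<in> carrier_mat n n"
  shows "pos_def_mat Y \<longleftrightarrow> transpose_mat Y = Y \<and>
    (\<forall>v \<in> carrier_vec n. v \<noteq> 0\<^sub>v n \<longrightarrow> v \<bullet> (Y *\<^sub>v v) > 0)"
  using assms unfolding pos_def_mat_def by auto

lemma pos_def_matD:
  assumes "pos_def_mat Y" "Y \<in> carrier_mat n n"
  shows "transpose_mat Y = Y"
    and "v \<in> carrier_vec n \<Longrightarrow> v \<noteq> 0\<^sub>v n \<Longrightarrow> v \<bullet> (Y *\<^sub>v v) > 0"
    and "v \<in> carrier_vec n \<Longrightarrow> v \<bullet> (Y *\<^sub>v v) \<ge> 0"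
proof -
  show t: "transpose_mat Y = Y" using assms pos_def_mat_iff by blast
  show pos: "v \<bullet> (Y *\<^sub>v v) > 0" if "v \<in> carrier_vec n" "v \<noteq> 0\<^sub>v n"
    using assms that pos_def_mat_iff by blast
  show "v \<bullet> (Y *\<^sub>v v) \<ge> 0" if "v \<in> carrier_vec n"
    using pos[OF that] that mult_mat_zero_vec[OF assms(2)] by (cases "v = 0\<^sub>v n") auto
qed

text \<open>The test vector splits as \<open>a @\<^sub>v b\<close>. Since \<open>B\<close> is the
  transpose of \<open>C\<close>, the two mixed products agree, which gives the factor 2. Both matrix
  inequalities are unfolded through this criterion.\<close>

lemma pos_def_four_block_iff:
  fixes A B C D :: "real mat"
  assumes A: "A \<in> carrier_mat n1 n1" "transpose_mat A = A"
    and D: "D \<in> carrier_mat n2 n2" "transpose_mat D = D"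
    and C: "C \<in> carrier_mat n2 n1" and B: "B = transpose_mat C"
  shows "pos_def_mat (four_block_mat A B C D) \<longleftrightarrow>
    (\<forall>a \<in> carrier_vec n1. \<forall>b \<in> carrier_vec n2. a \<noteq> 0\<^sub>v n1 \<or> b \<noteq> 0\<^sub>v n2 \<longrightarrow>
       a \<bullet> (A *\<^sub>v a) + 2 * (b \<bullet> (C *\<^sub>v a)) + b \<bullet> (D *\<^sub>v b) > 0)"
proof -
  let ?F = "four_block_mat A B C D"
  have B': "B \<in> carrier_mat n1 n2" using B C by auto
  have F: "?F \<in> carrier_mat (n1 + n2) (n1 + n2)" using A D by auto
  have sym: "transpose_mat ?F = ?F"
    using transpose_four_block_mat[OF A(1) B' C D(1)] A D B by simp
  have quad: "(a @\<^sub>v b) \<bullet> (?F *\<^sub>v (a @\<^sub>v b)) =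
      a \<bullet> (A *\<^sub>v a) + 2 * (b \<bullet> (C *\<^sub>v a)) + b \<bullet> (D *\<^sub>v b)"
    if a: "a \<in> carrier_vec n1" and b: "b \<in> carrier_vec n2" for a b
  proof -
    have c: "A *\<^sub>v a \<in> carrier_vec n1" "B *\<^sub>v b \<in> carrier_vec n1"
      "C *\<^sub>v a \<in> carrier_vec n2" "D *\<^sub>v b \<in> carrier_vec n2"
      using A B' C D a b by auto
    have "a \<bullet> (B *\<^sub>v b) = b \<bullet> (C *\<^sub>v a)"
      using transpose_vec_mult_scalar[OF C a b] B comm_scalar_prod[OF a c(2)] by simp
    then show ?thesis
      using a b c
      by (simp add: four_block_mat_mult_vec[OF A(1) B' C D(1) a b]
          scalar_prod_append[of _ n1 _ n2] scalar_prod_add_distrib[of _ n1]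
          scalar_prod_add_distrib[of _ n2])
  qed
  have zero: "a @\<^sub>v b = 0\<^sub>v (n1 + n2) \<longleftrightarrow> a = 0\<^sub>v n1 \<and> b = 0\<^sub>v n2"
    if a: "a \<in> carrier_vec n1" and b: "b \<in> carrier_vec n2" for a b :: "real vec"
  proof -
    have "0\<^sub>v (n1 + n2) = 0\<^sub>v n1 @\<^sub>v (0\<^sub>v n2 :: real vec)" by auto
    then show ?thesis using a append_vec_eq[of a n1 "0\<^sub>v n1" b "0\<^sub>v n2"] by simp
  qed
  have "pos_def_mat ?F \<longleftrightarrow>
    (\<forall>v \<in> carrier_vec (n1 + n2). v \<noteq> 0\<^sub>v (n1 + n2) \<longrightarrow> v \<bullet> (?F *\<^sub>v v) > 0)"
    using pos_def_mat_iff[OF F] sym by simp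
  also have "\<dots> \<longleftrightarrow> (\<forall>a \<in> carrier_vec n1. \<forall>b \<in> carrier_vec n2.
      a @\<^sub>v b \<noteq> 0\<^sub>v (n1 + n2) \<longrightarrow> (a @\<^sub>v b) \<bullet> (?F *\<^sub>v (a @\<^sub>v b)) > 0)"
    by (rule all_vec_append)
  finally show ?thesis using quad zero by simp
qed

section \<open>Linear duality by orthogonal projection\<close>

text \<open>These are the normal equations for projecting \<open>v\<close> onto the span of
  \<open>c 0\<close>, ..., \<open>c (T - 1)\<close>. The induction is a Gram-Schmidt step: project
  both \<open>v\<close> and the new vector \<open>c T\<close> onto the earlier span, then remove
  from the first residual its component along the second.\<close>

lemma projection_exists:
  fixes c :: "nat \<Rightarrow> nat \<Rightarrow> real" and v :: "nat \<Rightarrow> real"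
  shows "\<exists>g. \<forall>j<T. (\<Sum>l<k. c j l * (v l - (\<Sum>i<T. g i * c i l))) = 0"
proof (induction T arbitrary: v)
  case 0
  show ?case by simp
next
  case (Suc T)
  obtain g where g: "\<And>j. j < T \<Longrightarrow> (\<Sum>l<k. c j l * (v l - (\<Sum>i<T. g i * c i l))) = 0"
    using Suc[of v] by blast
  obtain h where h: "\<And>j. j < T \<Longrightarrow> (\<Sum>l<k. c j l * (c T l - (\<Sum>i<T. h i * c i l))) = 0"
    using Suc[of "c T"] by blast
  define s where "s l = v l - (\<Sum>i<T. g i * c i l)" for l
  define r where "r l = c T l - (\<Sum>i<T. h i * c i l)" for l
  \<comment> \<open>The projection coefficient of \<open>s\<close> along \<open>r\<close>. If
    \<open>c T\<close> already lies in the earlier span, then \<open>r\<close> vanishes, the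
    division by zero gives 0, and \<open>rs\<close> below holds because both of its sides are
    0.\<close>
  define \<alpha> where "\<alpha> = (\<Sum>l<k. r l * s l) / (\<Sum>l<k. r l * r l)"
  have cs: "(\<Sum>l<k. c j l * s l) = 0" and cr: "(\<Sum>l<k. c j l * r l) = 0" if "j < T" for j
    using g[OF that] h[OF that] unfolding s_def r_def by simp_all
  \<comment> \<open>\<open>r\<close> differs from \<open>c T\<close> by a combination of earlier
    vectors, so a vector orthogonal to these has the same product with both.\<close>
  have cT: "(\<Sum>l<k. c T l * u l) = (\<Sum>l<k. r l * u l)"
    if "\<And>j. j < T \<Longrightarrow> (\<Sum>l<k. c j l * u l) = 0" for u
  proof -
    have "(\<Sum>l<k. (\<Sum>i<T. h i * c i l) * u l) = (\<Sum>i<T. h i * (\<Sum>l<k. c i l * u l))"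
      by (subst sum_distrib_left, subst sum.swap) (simp add: sum_distrib_right mult.assoc)
    also have "\<dots> = 0" using that by simp
    finally show ?thesis
      unfolding r_def by (simp add: left_diff_distrib sum_subtractf)
  qed
  have rs: "(\<Sum>l<k. r l * s l) = \<alpha> * (\<Sum>l<k. r l * r l)"
  proof (cases "(\<Sum>l<k. r l * r l) = 0")
    case True
    then have "\<forall>l\<in>{..<k}. r l * r l = 0" by (subst (asm) sum_nonneg_eq_0_iff) auto
    then show ?thesis by simp
  qed (simp add: \<alpha>_def)
  \<comment> \<open>Subtracting \<alpha> times \<open>r\<close> puts the coefficient \<alpha> on
    \<open>c T\<close> and, since \<open>r\<close> is itself a residual, corrects the earlier
    coefficients by \<alpha> times \<open>h\<close>.\<close>
  define g' where "g' i = (if i < T then g i - \<alpha> * h i else \<alpha>)" for i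
  have res: "v l - (\<Sum>i<Suc T. g' i * c i l) = s l - \<alpha> * r l" for l
    unfolding g'_def s_def r_def
    by (simp add: left_diff_distrib sum_subtractf sum_distrib_left algebra_simps)
  have "(\<Sum>l<k. c j l * (s l - \<alpha> * r l)) = 0" if "j < Suc T" for j
  proof -
    have "(\<Sum>l<k. c j l * (s l - \<alpha> * r l)) = (\<Sum>l<k. c j l * s l) - \<alpha> * (\<Sum>l<k. c j l * r l)"
      by (simp add: right_diff_distrib sum_subtractf sum_distrib_left algebra_simps)
    also have "\<dots> = 0"
    proof (cases "j = T")
      case True
      then show ?thesis using cT[of s] cT[of r] cs cr rs by simp
    next
      case False
      then show ?thesis using cs cr that by simp
    qed
    finally show ?thesis .
  qed
  then show ?case by (intro exI[of _ g']) (simp only: res, blast)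
qed

text \<open>A Fredholm alternative, column by column: project column \<open>j\<close> of
  \<open>V\<close> onto the column space of \<open>W\<close>. The residual annihilates the columns
  of \<open>W\<close>, hence by \<open>ker\<close> also column \<open>j\<close> of \<open>V\<close>,
  hence itself, so it is zero.\<close>

lemma factors_through_if_left_kernel_subset:
  fixes W V :: "real mat"
  assumes W: "W \<in> carrier_mat k T" and V: "V \<in> carrier_mat k n"
    and ker: "\<And>w. w \<in> carrier_vec k \<Longrightarrow> (\<And>t. t < T \<Longrightarrow> w \<bullet> col W t = 0) \<Longrightarrow>
      (\<And>j. j < n \<Longrightarrow> w \<bullet> col V j = 0)"
  shows "\<exists>\<Gamma> \<in> carrier_mat T n. W * \<Gamma> = V"
proof -
  have "\<exists>g. \<forall>t<T. (\<Sum>l<k. W $$ (l, t) * (V $$ (l, j) - (\<Sum>i<T. g i * W $$ (l, i)))) = 0" for j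
    by (rule projection_exists[where c = "\<lambda>i l. W $$ (l, i)" and v = "\<lambda>l. V $$ (l, j)"])
  then have "\<exists>g. \<forall>j. \<forall>t<T.
      (\<Sum>l<k. W $$ (l, t) * (V $$ (l, j) - (\<Sum>i<T. g j i * W $$ (l, i)))) = 0"
    by (intro choice) blast
  then obtain g where g: "\<And>j t. t < T \<Longrightarrow>
      (\<Sum>l<k. W $$ (l, t) * (V $$ (l, j) - (\<Sum>i<T. g j i * W $$ (l, i)))) = 0"
    by blast
  define \<Gamma> where "\<Gamma> = mat T n (\<lambda>(i, j). g j i)"
  have \<Gamma>: "\<Gamma> \<in> carrier_mat T n" unfolding \<Gamma>_def by simp
  have W\<Gamma>: "(W * \<Gamma>) $$ (l, j) = (\<Sum>i<T. g j i * W $$ (l, i))" if "l < k" "j < n" for l j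
    using that W unfolding \<Gamma>_def
    by (auto simp: scalar_prod_def atLeast0LessThan mult.commute intro!: sum.cong)
  have "W * \<Gamma> = V"
  proof (rule eq_matI)
    fix l j assume "l < dim_row V" "j < dim_col V"
    then have l: "l < k" and j: "j < n" using V by auto
    define w where "w = vec k (\<lambda>l. V $$ (l, j) - (\<Sum>i<T. g j i * W $$ (l, i)))"
    have w: "w \<in> carrier_vec k" unfolding w_def by simp
    have dot: "w \<bullet> u = (\<Sum>l<k. u $ l * (V $$ (l, j) - (\<Sum>i<T. g j i * W $$ (l, i))))"
      if "u \<in> carrier_vec k" for u
      using that unfolding w_def
      by (auto simp: scalar_prod_def atLeast0LessThan mult.commute intro!: sum.cong)
    have wW: "w \<bullet> col W t = 0" if "t < T" for t
      using g[OF that, of j] that W by (subst dot) auto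
    have wV: "w \<bullet> col V j = 0" using ker[OF w wW j] by simp
    have weq: "w = col V j - W *\<^sub>v col \<Gamma> j"
      using V W \<Gamma> j W\<Gamma> unfolding w_def by (intro eq_vecI) auto
    have wW\<Gamma>: "w \<bullet> (W *\<^sub>v col \<Gamma> j) = (\<Sum>i<T. g j i * (w \<bullet> col W i))"
    proof -
      have "w \<bullet> (W *\<^sub>v col \<Gamma> j) = (\<Sum>l<k. w $ l * (\<Sum>i<T. g j i * W $$ (l, i)))"
        using W \<Gamma> j W\<Gamma> by (auto simp: scalar_prod_def atLeast0LessThan intro!: sum.cong)
      also have "\<dots> = (\<Sum>i<T. \<Sum>l<k. w $ l * (g j i * W $$ (l, i)))"
        by (subst sum.swap) (simp add: sum_distrib_left)
      also have "\<dots> = (\<Sum>i<T. g j i * (w \<bullet> col W i))"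
        using W by (auto simp: scalar_prod_def atLeast0LessThan sum_distrib_left
            intro!: sum.cong)
      finally show ?thesis .
    qed
    \<comment> \<open>Expanding only the second factor leaves a product with column \<open>j\<close>
      of \<open>V\<close> and a combination of products with columns of \<open>W\<close>, all of
      which vanish.\<close>
    have "w \<bullet> w = w \<bullet> (col V j - W *\<^sub>v col \<Gamma> j)"
      by (rule arg_cong[OF weq])
    also have "\<dots> = w \<bullet> col V j - w \<bullet> (W *\<^sub>v col \<Gamma> j)"
      using w V W \<Gamma> j by (intro scalar_prod_minus_distrib[of _ k]) auto
    finally have "w \<bullet> w = 0" using wW wV wW\<Gamma> by simp
    then have "w = 0\<^sub>v k" using scalar_prod_self_pos[OF w] by force
    then have "w $ l = 0" using l by simp
    then show "(W * \<Gamma>) $$ (l, j) = V $$ (l, j)" using l j W\<Gamma> unfolding w_def by simp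
  qed (use W V \<Gamma> in auto)
  then show ?thesis using \<Gamma> by blast
qed

section \<open>Inverses of symmetric and positive definite matrices\<close>

lemma symmetric_inverse:
  fixes Y P :: "real mat"
  assumes Y: "Y \<in> carrier_mat n n" "transpose_mat Y = Y" and P: "P \<in> carrier_mat n n"
    and YP: "Y * P = 1\<^sub>m n"
  shows "transpose_mat P = P"
proof -
  have PtY: "transpose_mat P * Y = 1\<^sub>m n"
    using transpose_mult[OF Y(1) P] Y(2) YP by simp
  have "transpose_mat P = transpose_mat P * (Y * P)" using YP P by simp
  also have "\<dots> = transpose_mat P * Y * P" using Y P by simp
  also have "\<dots> = P" using PtY P by simp
  finally show ?thesis .
qed

lemma mult_mat_vec_inverse:
  fixes Y P :: "real mat"
  assumes "Y \<in> carrier_mat n n" "P \<in> carrier_mat n n" "Y * P = 1\<^sub>m n" "v \<in> carrier_vec n"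
  shows "Y *\<^sub>v (P *\<^sub>v v) = v"
  using assms by (metis assoc_mult_mat_vec one_mult_mat_vec)

text \<open>Writing \<open>v\<close> as \<open>Y *\<^sub>v (P *\<^sub>v v)\<close> turns the form of
  \<open>P\<close> at \<open>v\<close> into the form of \<open>Y\<close> at
  \<open>P *\<^sub>v v\<close>.\<close>

lemma pos_def_inverse:
  fixes Y P :: "real mat"
  assumes Y: "Y \<in> carrier_mat n n" "pos_def_mat Y" and P: "P \<in> carrier_mat n n"
    and YP: "Y * P = 1\<^sub>m n"
  shows "pos_def_mat P"
  unfolding pos_def_mat_iff[OF P]
proof (intro conjI ballI impI)
  show "transpose_mat P = P" by (rule symmetric_inverse[OF Y(1) pos_def_matD(1)[OF Y(2,1)] P YP])
  fix v :: "real vec" assume v: "v \<in> carrier_vec n" "v \<noteq> 0\<^sub>v n"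
  have Pv: "P *\<^sub>v v \<in> carrier_vec n" using P v by simp
  have YPv: "Y *\<^sub>v (P *\<^sub>v v) = v" using mult_mat_vec_inverse[OF Y(1) P YP v(1)] .
  have "P *\<^sub>v v \<noteq> 0\<^sub>v n" using YPv v mult_mat_zero_vec[OF Y(1)] by auto
  then have "(P *\<^sub>v v) \<bullet> (Y *\<^sub>v (P *\<^sub>v v)) > 0" by (rule pos_def_matD(2)[OF Y(2,1) Pv])
  then show "v \<bullet> (P *\<^sub>v v) > 0" unfolding YPv comm_scalar_prod[OF v(1) Pv] .
qed

section \<open>The matrix inequalities expressed through the inverse of Y\<close>

lemma pos_def_block3_iff:
  fixes Y G H :: "real mat"
  assumes Y: "Y \<in> carrier_mat n n" "transpose_mat Y = Y"
    and G: "G \<in> carrier_mat n n" and H: "H \<in> carrier_mat p n"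
  shows "pos_def_mat (four_block_mat Y
      (four_block_mat (transpose_mat G) (transpose_mat H) (0\<^sub>m 0 n) (0\<^sub>m 0 p))
      (G @\<^sub>r H)
      (four_block_mat Y (0\<^sub>m n p) (0\<^sub>m p n) (1\<^sub>m p))) \<longleftrightarrow>
    (\<forall>y \<in> carrier_vec n. \<forall>a \<in> carrier_vec n. \<forall>b \<in> carrier_vec p.
      y \<noteq> 0\<^sub>v n \<or> a \<noteq> 0\<^sub>v n \<or> b \<noteq> 0\<^sub>v p \<longrightarrow>
      y \<bullet> (Y *\<^sub>v y) + 2 * (a \<bullet> (G *\<^sub>v y) + b \<bullet> (H *\<^sub>v y)) + (a \<bullet> (Y *\<^sub>v a) + b \<bullet> b) > 0)"
proof -
  let ?D = "four_block_mat Y (0\<^sub>m n p) (0\<^sub>m p n) (1\<^sub>m p)"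
  have GH: "G @\<^sub>r H \<in> carrier_mat (n + p) n" using G H by (rule carrier_append_rows)
  have D: "?D \<in> carrier_mat (n + p) (n + p)" using Y by simp
  have Dt: "transpose_mat ?D = ?D"
    using transpose_four_block_mat[OF Y(1), of "0\<^sub>m n p" p "0\<^sub>m p n" p "1\<^sub>m p"] Y(2) by simp
  \<comment> \<open>\<open>append_rows\<close> is a block matrix with empty right-hand blocks;
    transposing turns these into the empty bottom blocks of the encoded block row. The nested matrix
    thus has the shape required by \<open>pos_def_four_block_iff\<close>.\<close>
  have B: "four_block_mat (transpose_mat G) (transpose_mat H) (0\<^sub>m 0 n) (0\<^sub>m 0 p) =
      transpose_mat (G @\<^sub>r H)"
    unfolding append_rows_def
    using transpose_four_block_mat[OF G, of "0\<^sub>m n 0" 0 H p "0\<^sub>m p 0"] G H by simp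
  have zero: "a @\<^sub>v b = 0\<^sub>v (n + p) \<longleftrightarrow> a = 0\<^sub>v n \<and> b = 0\<^sub>v p"
    if "a \<in> carrier_vec n" for a b :: "real vec"
  proof -
    have "0\<^sub>v (n + p) = 0\<^sub>v n @\<^sub>v (0\<^sub>v p :: real vec)" by auto
    then show ?thesis using that append_vec_eq[of a n "0\<^sub>v n" b "0\<^sub>v p"] by simp
  qed
  have quad: "(a @\<^sub>v b) \<bullet> ((G @\<^sub>r H) *\<^sub>v y) = a \<bullet> (G *\<^sub>v y) + b \<bullet> (H *\<^sub>v y)"
    "(a @\<^sub>v b) \<bullet> (?D *\<^sub>v (a @\<^sub>v b)) = a \<bullet> (Y *\<^sub>v a) + b \<bullet> b"
    if "y \<in> carrier_vec n" "a \<in> carrier_vec n" "b \<in> carrier_vec p" for y a b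
    using that G H Y
    by (simp_all add: mat_mult_append[OF G H] mult_mat_vec_split[OF Y(1) one_carrier_mat]
        scalar_prod_append[of _ n _ p])
  show ?thesis
    unfolding pos_def_four_block_iff[OF Y D Dt GH B] all_vec_append
    using quad zero by auto
qed

text \<open>With \<open>y = P v\<close>, \<open>a = w - P M v\<close> and \<open>b = u - N v\<close>, where \<open>P\<close> is the inverse of \<open>Y\<close>, the
  quadratic form of the block matrix splits into the Lyapunov decrease at \<open>v\<close> plus the
  squares of \<open>w\<close> and \<open>u\<close>.\<close>

lemma block3_complete_square:
  fixes Y P M N :: "real mat"
  assumes Y: "Y \<in> carrier_mat n n" "transpose_mat Y = Y"
    and P: "P \<in> carrier_mat n n" "Y * P = 1\<^sub>m n" "P * Y = 1\<^sub>m n"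
    and M: "M \<in> carrier_mat n n" and N: "N \<in> carrier_mat p n"
    and y: "y \<in> carrier_vec n" and a: "a \<in> carrier_vec n" and b: "b \<in> carrier_vec p"
    and v: "v = Y *\<^sub>v y"
  shows "y \<bullet> (Y *\<^sub>v y) + 2 * (a \<bullet> ((M * Y) *\<^sub>v y) + b \<bullet> ((N * Y) *\<^sub>v y)) + (a \<bullet> (Y *\<^sub>v a) + b \<bullet> b) =
    v \<bullet> (P *\<^sub>v v) - (M *\<^sub>v v) \<bullet> (P *\<^sub>v (M *\<^sub>v v)) - (N *\<^sub>v v) \<bullet> (N *\<^sub>v v) +
    (a + P *\<^sub>v (M *\<^sub>v v)) \<bullet> (Y *\<^sub>v (a + P *\<^sub>v (M *\<^sub>v v))) + (b + N *\<^sub>v v) \<bullet> (b + N *\<^sub>v v)"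
proof -
  have vn: "v \<in> carrier_vec n" using v Y y by simp
  have Mv: "M *\<^sub>v v \<in> carrier_vec n" and Nv: "N *\<^sub>v v \<in> carrier_vec p" using M N vn by auto
  have PMv: "P *\<^sub>v (M *\<^sub>v v) \<in> carrier_vec n" using P Mv by auto
  have Py: "P *\<^sub>v v = y" unfolding v using mult_mat_vec_inverse[OF P(1) Y(1) P(3) y] .
  have YPMv: "Y *\<^sub>v (P *\<^sub>v (M *\<^sub>v v)) = M *\<^sub>v v" using mult_mat_vec_inverse[OF Y(1) P(1,2) Mv] .
  have MY: "(M * Y) *\<^sub>v y = M *\<^sub>v v" "(N * Y) *\<^sub>v y = N *\<^sub>v v" unfolding v using M N Y y by auto
  have "(b + N *\<^sub>v v) \<bullet> (b + N *\<^sub>v v) = b \<bullet> b + 2 * (b \<bullet> (N *\<^sub>v v)) + (N *\<^sub>v v) \<bullet> (N *\<^sub>v v)"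
    using quadratic_form_add[of "1\<^sub>m p" p b "N *\<^sub>v v"] b Nv by simp
  moreover have "y \<bullet> (Y *\<^sub>v y) = v \<bullet> (P *\<^sub>v v)"
    unfolding Py v[symmetric] using comm_scalar_prod[OF y vn] .
  moreover have "(P *\<^sub>v (M *\<^sub>v v)) \<bullet> (M *\<^sub>v v) = (M *\<^sub>v v) \<bullet> (P *\<^sub>v (M *\<^sub>v v))"
    using comm_scalar_prod[OF PMv Mv] .
  ultimately show ?thesis
    unfolding MY quadratic_form_add[OF Y a PMv] YPMv by simp
qed

text \<open>A Schur complement argument by completing squares: for fixed \<open>y\<close> the form
  is smallest in \<open>a\<close> and \<open>b\<close> where both squares vanish, and what remains
  is the Lyapunov decrease at \<open>v = Y *\<^sub>v y\<close>. As \<open>Y\<close> is invertible,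
  \<open>v\<close> ranges over all vectors.\<close>

lemma pos_def_block3_iff_lyapunov:
  fixes Y P M N :: "real mat"
  assumes Y_carrier: "Y \<in> carrier_mat n n" and Y_pd: "pos_def_mat Y"
    and P: "P \<in> carrier_mat n n" "Y * P = 1\<^sub>m n" "P * Y = 1\<^sub>m n"
    and M: "M \<in> carrier_mat n n" and N: "N \<in> carrier_mat p n"
  shows "pos_def_mat (four_block_mat Y
      (four_block_mat (transpose_mat (M * Y)) (transpose_mat (N * Y)) (0\<^sub>m 0 n) (0\<^sub>m 0 p))
      ((M * Y) @\<^sub>r (N * Y))
      (four_block_mat Y (0\<^sub>m n p) (0\<^sub>m p n) (1\<^sub>m p))) \<longleftrightarrow>
    (\<forall>v \<in> carrier_vec n. v \<noteq> 0\<^sub>v n \<longrightarrow>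
      (M *\<^sub>v v) \<bullet> (P *\<^sub>v (M *\<^sub>v v)) + (N *\<^sub>v v) \<bullet> (N *\<^sub>v v) < v \<bullet> (P *\<^sub>v v))"
    (is "?L \<longleftrightarrow> ?R")
proof -
  note Y = Y_carrier pos_def_matD(1)[OF Y_pd Y_carrier]
  note Y_pos = pos_def_matD(2)[OF Y_pd Y_carrier] and Y0 = pos_def_matD(3)[OF Y_pd Y_carrier]
  have MY: "M * Y \<in> carrier_mat n n" and NY: "N * Y \<in> carrier_mat p n" using M N Y by auto
  note square = block3_complete_square[OF Y P M N]
  note block = pos_def_block3_iff[OF Y MY NY]
  have Y0: "v \<bullet> (Y *\<^sub>v v) \<ge> 0" if "v \<in> carrier_vec n" for v
    using Y_pos[OF that] that Y by (cases "v = 0\<^sub>v n") auto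
  show ?thesis
  proof
    assume L: ?L
    show ?R
    proof (intro ballI impI)
      fix v :: "real vec" assume v: "v \<in> carrier_vec n" "v \<noteq> 0\<^sub>v n"
      define y where "y = P *\<^sub>v v"
      have y: "y \<in> carrier_vec n" unfolding y_def using P v by simp
      have Yy: "v = Y *\<^sub>v y" unfolding y_def using mult_mat_vec_inverse[OF Y(1) P(1,2) v(1)] by simp
      then have y0: "y \<noteq> 0\<^sub>v n" using v mult_mat_zero_vec[OF Y(1)] by auto
      \<comment> \<open>The minimizing choice of \<open>a\<close> and \<open>b\<close>: both squares
        become zero, so positivity of the block form is exactly the strict decrease at
        \<open>v\<close>.\<close>
      define a where "a = - (P *\<^sub>v (M *\<^sub>v v))"
      define b where "b = - (N *\<^sub>v v)"
      have PMv: "P *\<^sub>v (M *\<^sub>v v) \<in> carrier_vec n" and Nv: "N *\<^sub>v v \<in> carrier_vec p"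
        using P M N v by auto
      have a: "a \<in> carrier_vec n" and b: "b \<in> carrier_vec p"
        unfolding a_def b_def using PMv Nv by auto
      have "a + P *\<^sub>v (M *\<^sub>v v) = 0\<^sub>v n" "b + N *\<^sub>v v = 0\<^sub>v p"
        unfolding a_def b_def using PMv Nv by auto
      then show "(M *\<^sub>v v) \<bullet> (P *\<^sub>v (M *\<^sub>v v)) + (N *\<^sub>v v) \<bullet> (N *\<^sub>v v) < v \<bullet> (P *\<^sub>v v)"
        using L[unfolded block, rule_format, OF y a b] y0 square[OF y a b Yy] mult_mat_zero_vec[OF Y(1)] by auto
    qed
  next
    assume R: ?R
    show ?L
      unfolding block
    proof (intro ballI impI)
      fix y a b :: "real vec"
      assume y: "y \<in> carrier_vec n" and a: "a \<in> carrier_vec n" and b: "b \<in> carrier_vec p"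
        and nz: "y \<noteq> 0\<^sub>v n \<or> a \<noteq> 0\<^sub>v n \<or> b \<noteq> 0\<^sub>v p"
      show "y \<bullet> (Y *\<^sub>v y) + 2 * (a \<bullet> ((M * Y) *\<^sub>v y) + b \<bullet> ((N * Y) *\<^sub>v y)) + (a \<bullet> (Y *\<^sub>v a) + b \<bullet> b) > 0"
      \<comment> \<open>At \<open>y = 0\<close> the decrease is no longer strict, so positivity has
        to come from \<open>a\<close> and \<open>b\<close>, one of which is then nonzero.\<close>
      proof (cases "y = 0\<^sub>v n")
        case True
        have "(M * Y) *\<^sub>v y = 0\<^sub>v n" "(N * Y) *\<^sub>v y = 0\<^sub>v p" "Y *\<^sub>v y = 0\<^sub>v n"
          unfolding True using mult_mat_zero_vec MY NY Y(1) by blast+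
        moreover have "a \<bullet> (Y *\<^sub>v a) + b \<bullet> b > 0"
          using nz True Y_pos[OF a] Y0[OF a] scalar_prod_self_pos[OF b] scalar_prod_self_nonneg[of b]
          by (cases "a = 0\<^sub>v n") auto
        ultimately show ?thesis using y a b by simp
      next
        case False
        let ?v = "Y *\<^sub>v y"
        have v: "?v \<in> carrier_vec n" using Y y by simp
        have "P *\<^sub>v ?v = y" using mult_mat_vec_inverse[OF P(1) Y(1) P(3) y] .
        then have "?v \<noteq> 0\<^sub>v n" using False mult_mat_zero_vec[OF P(1)] by auto
        moreover have "a + P *\<^sub>v (M *\<^sub>v ?v) \<in> carrier_vec n" using a P M v by auto
        ultimately show ?thesis
          using R[rule_format, OF v] Y0[of "a + P *\<^sub>v (M *\<^sub>v ?v)"]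
            scalar_prod_self_nonneg[of "b + N *\<^sub>v ?v"] square[OF y a b refl] by linarith
      qed
    qed
  qed
qed

text \<open>The Schur complement of \<open>Y\<close>: up to a square in the form of
  \<open>Y\<close>, the bordered form is the square of the scalar component times the gap between
  \<gamma> and the form of \<open>P\<close> at \<open>x0\<close>.\<close>

lemma pos_def_bordered_iff:
  fixes Y P :: "real mat" and x0 :: "real vec"
  assumes Y_carrier: "Y \<in> carrier_mat n n" and Y_pd: "pos_def_mat Y"
    and P: "P \<in> carrier_mat n n" "Y * P = 1\<^sub>m n" "P * Y = 1\<^sub>m n"
    and x0: "x0 \<in> carrier_vec n"
  shows "pos_def_mat (four_block_mat (mat 1 1 (\<lambda>_. \<gamma>)) (mat_of_rows n [x0]) (mat_of_cols n [x0]) Y)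
    \<longleftrightarrow> x0 \<bullet> (P *\<^sub>v x0) < \<gamma>" (is "pos_def_mat ?F \<longleftrightarrow> _")
proof -
  note Y = Y_carrier pos_def_matD(1)[OF Y_pd Y_carrier]
  note Y_pos = pos_def_matD(2)[OF Y_pd Y_carrier] and Y0 = pos_def_matD(3)[OF Y_pd Y_carrier]
  let ?g = "mat 1 1 (\<lambda>_. \<gamma>)"
  have g: "?g \<in> carrier_mat 1 1" "transpose_mat ?g = ?g" by auto
  have C: "mat_of_cols n [x0] \<in> carrier_mat n 1" by auto
  have B: "mat_of_rows n [x0] = transpose_mat (mat_of_cols n [x0])"
    by (simp add: transpose_mat_of_cols)
  note block = pos_def_four_block_iff[OF g Y C B]
  have Y0: "v \<bullet> (Y *\<^sub>v v) \<ge> 0" if "v \<in> carrier_vec n" for v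
    using Y_pos[OF that] that Y by (cases "v = 0\<^sub>v n") auto
  have Px0: "P *\<^sub>v x0 \<in> carrier_vec n" using P x0 by simp
  have YPx0: "Y *\<^sub>v (P *\<^sub>v x0) = x0" using mult_mat_vec_inverse[OF Y(1) P(1,2) x0] .
  have square: "s \<bullet> (?g *\<^sub>v s) + 2 * (y \<bullet> (mat_of_cols n [x0] *\<^sub>v s)) + y \<bullet> (Y *\<^sub>v y) =
      (s $ 0)\<^sup>2 * (\<gamma> - x0 \<bullet> (P *\<^sub>v x0)) +
      (y + s $ 0 \<cdot>\<^sub>v (P *\<^sub>v x0)) \<bullet> (Y *\<^sub>v (y + s $ 0 \<cdot>\<^sub>v (P *\<^sub>v x0)))"
    if s: "s \<in> carrier_vec 1" and y: "y \<in> carrier_vec n" for s y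
  proof -
    have "?g *\<^sub>v s = \<gamma> \<cdot>\<^sub>v s" using s by (intro eq_vecI) (auto simp: scalar_prod_def)
    then have 1: "s \<bullet> (?g *\<^sub>v s) = (s $ 0)\<^sup>2 * \<gamma>"
      using s by (simp add: scalar_prod_def power2_eq_square)
    have "mat_of_cols n [x0] *\<^sub>v s = s $ 0 \<cdot>\<^sub>v x0"
      using s x0 by (intro eq_vecI) (auto simp: scalar_prod_def mat_of_cols_def)
    then have 2: "y \<bullet> (mat_of_cols n [x0] *\<^sub>v s) = s $ 0 * (y \<bullet> x0)" using y x0 by simp
    have "Y *\<^sub>v (s $ 0 \<cdot>\<^sub>v (P *\<^sub>v x0)) = s $ 0 \<cdot>\<^sub>v x0"
      using mult_mat_vec[OF Y(1) Px0] YPx0 by simp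
    moreover have "(P *\<^sub>v x0) \<bullet> x0 = x0 \<bullet> (P *\<^sub>v x0)" using comm_scalar_prod[OF Px0 x0] .
    ultimately show ?thesis
      unfolding 1 2 quadratic_form_add[OF Y y smult_carrier_vec[THEN iffD2, OF Px0]]
      using y x0 Px0 by (simp add: power2_eq_square algebra_simps)
  qed
  show ?thesis
  proof
    assume L: "pos_def_mat ?F"
    define s :: "real vec" where "s = vec 1 (\<lambda>_. 1)"
    have s: "s \<in> carrier_vec 1" "s $ 0 = 1" unfolding s_def by auto
    have s0: "s \<noteq> 0\<^sub>v 1" using s(2) by auto
    \<comment> \<open>Together with scalar component 1 this makes the square vanish and isolates the
      gap.\<close>
    define y where "y = - (P *\<^sub>v x0)"
    have y: "y \<in> carrier_vec n" unfolding y_def using Px0 by simp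
    have "y + s $ 0 \<cdot>\<^sub>v (P *\<^sub>v x0) = 0\<^sub>v n" unfolding y_def s(2) using Px0 by auto
    then show "x0 \<bullet> (P *\<^sub>v x0) < \<gamma>"
      using L[unfolded block, rule_format, OF s(1) y] s0 square[OF s(1) y] s(2) mult_mat_zero_vec[OF Y(1)] by auto
  next
    assume R: "x0 \<bullet> (P *\<^sub>v x0) < \<gamma>"
    show "pos_def_mat ?F"
      unfolding block
    proof (intro ballI impI)
      fix s y :: "real vec"
      assume s: "s \<in> carrier_vec 1" and y: "y \<in> carrier_vec n" and nz: "s \<noteq> 0\<^sub>v 1 \<or> y \<noteq> 0\<^sub>v n"
      show "s \<bullet> (?g *\<^sub>v s) + 2 * (y \<bullet> (mat_of_cols n [x0] *\<^sub>v s)) + y \<bullet> (Y *\<^sub>v y) > 0"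
      proof (cases "s $ 0 = 0")
        case True
        then have "s = 0\<^sub>v 1" using s by (intro eq_vecI) auto
        then have "y \<noteq> 0\<^sub>v n" using nz by simp
        moreover have "y + s $ 0 \<cdot>\<^sub>v (P *\<^sub>v x0) = y" unfolding True using y P(1) by (intro eq_vecI) auto
        ultimately show ?thesis
          unfolding square[OF s y] using True Y_pos[OF y] by simp
      next
        case False
        have "y + s $ 0 \<cdot>\<^sub>v (P *\<^sub>v x0) \<in> carrier_vec n" using y Px0 by simp
        moreover have "(s $ 0)\<^sup>2 * (\<gamma> - x0 \<bullet> (P *\<^sub>v x0)) > 0" using False R by simp
        ultimately show ?thesis unfolding square[OF s y] using Y0 by (simp add: add_pos_nonneg)
      qed
    qed
  qed
qed

section \<open>A Lyapunov inequality gives stability and a cost bound\<close>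

lemma quadratic_form_lincomb:
  fixes P :: "real mat"
  assumes P: "P \<in> carrier_mat n n" "transpose_mat P = P"
    and a: "a \<in> carrier_vec n" and b: "b \<in> carrier_vec n"
  shows "(s \<cdot>\<^sub>v a + t \<cdot>\<^sub>v b) \<bullet> (P *\<^sub>v (s \<cdot>\<^sub>v a + t \<cdot>\<^sub>v b)) =
    s\<^sup>2 * (a \<bullet> (P *\<^sub>v a)) + 2 * s * t * (a \<bullet> (P *\<^sub>v b)) + t\<^sup>2 * (b \<bullet> (P *\<^sub>v b))"
proof -
  have c: "P *\<^sub>v a \<in> carrier_vec n" "P *\<^sub>v b \<in> carrier_vec n" using P a b by auto
  have sa: "s \<cdot>\<^sub>v a \<in> carrier_vec n" and tb: "t \<cdot>\<^sub>v b \<in> carrier_vec n" using a b by auto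
  show ?thesis
    unfolding quadratic_form_add[OF P sa tb] mult_mat_vec[OF P(1) a] mult_mat_vec[OF P(1) b]
    using a b c by (simp add: power2_eq_square)
qed

lemma Re_Im_mult_mat_vec:
  fixes M :: "real mat" and v :: "complex vec"
  assumes "M \<in> carrier_mat n n" "v \<in> carrier_vec n"
  shows "map_vec Re (map_mat complex_of_real M *\<^sub>v v) = M *\<^sub>v map_vec Re v"
    and "map_vec Im (map_mat complex_of_real M *\<^sub>v v) = M *\<^sub>v map_vec Im v"
  using assms by (auto simp: scalar_prod_def intro!: eq_vecI sum.cong)

text \<open>For a complex eigenvector with real part \<open>a\<close> and imaginary part
  \<open>b\<close>, the sum of the forms of \<open>P\<close> at \<open>a\<close> and
  \<open>b\<close> is the Hermitian form of \<open>P\<close> at the eigenvector. Applying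
  \<open>M\<close> multiplies it by the squared modulus of \<open>z\<close>, while the decrease at
  \<open>a\<close> and \<open>b\<close> makes it smaller.\<close>

lemma lyapunov_imp_stable:
  fixes M P :: "real mat"
  assumes M: "M \<in> carrier_mat n n" and P: "P \<in> carrier_mat n n" "pos_def_mat P"
    and decr: "\<And>v. v \<in> carrier_vec n \<Longrightarrow> v \<noteq> 0\<^sub>v n \<Longrightarrow>
      (M *\<^sub>v v) \<bullet> (P *\<^sub>v (M *\<^sub>v v)) < v \<bullet> (P *\<^sub>v v)"
  shows "stable_mat M"
  unfolding stable_mat_def
proof (intro conjI allI impI)
  show "square_mat M" using M by simp
  fix z assume "eigenvalue (map_mat complex_of_real M) z"
  then obtain v where v: "v \<in> carrier_vec n" "v \<noteq> 0\<^sub>v n"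
    and Mv: "map_mat complex_of_real M *\<^sub>v v = z \<cdot>\<^sub>v v"
    using M unfolding eigenvalue_def eigenvector_def by auto
  define a where "a = map_vec Re v"
  define b where "b = map_vec Im v"
  have a: "a \<in> carrier_vec n" and b: "b \<in> carrier_vec n" unfolding a_def b_def using v by auto
  have Ma: "M *\<^sub>v a = Re z \<cdot>\<^sub>v a + (- Im z) \<cdot>\<^sub>v b"
    unfolding a_def b_def Re_Im_mult_mat_vec(1)[OF M v(1), symmetric] Mv
    using v by (intro eq_vecI) auto
  have Mb: "M *\<^sub>v b = Im z \<cdot>\<^sub>v a + Re z \<cdot>\<^sub>v b"
    unfolding a_def b_def Re_Im_mult_mat_vec(2)[OF M v(1), symmetric] Mv
    using v by (intro eq_vecI) auto
  define q where "q x = x \<bullet> (P *\<^sub>v x)" for x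
  \<comment> \<open>The mixed terms in \<open>a\<close> and \<open>b\<close> enter with opposite
    signs and cancel.\<close>
  have "q (M *\<^sub>v a) + q (M *\<^sub>v b) = ((Re z)\<^sup>2 + (Im z)\<^sup>2) * (q a + q b)"
    unfolding q_def Ma Mb quadratic_form_lincomb[OF P(1) pos_def_matD(1)[OF P(2,1)] a b] by (simp add: algebra_simps)
  \<comment> \<open>At least one of \<open>a\<close> and \<open>b\<close> is nonzero and supplies
    strictness; a vanishing one contributes 0 to both sides.\<close>
  moreover have "q (M *\<^sub>v a) + q (M *\<^sub>v b) < q a + q b" and q_pos: "q a + q b > 0"
  proof -
    have q0: "q (0\<^sub>v n) = 0" "M *\<^sub>v 0\<^sub>v n = 0\<^sub>v n"
      using P M unfolding q_def by (auto simp: mult_mat_zero_vec)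
    have "a \<noteq> 0\<^sub>v n \<or> b \<noteq> 0\<^sub>v n"
    proof (rule ccontr)
      assume "\<not> ?thesis"
      then have ab: "a = 0\<^sub>v n" "b = 0\<^sub>v n" by auto
      have "v = 0\<^sub>v n"
      proof (rule eq_vecI)
        fix i assume "i < dim_vec (0\<^sub>v n :: complex vec)"
        then have i: "i < n" by simp
        have "a $ i = 0" "b $ i = 0" using ab i by simp_all
        then have "Re (v $ i) = 0" "Im (v $ i) = 0" using i v unfolding a_def b_def by auto
        then show "v $ i = 0\<^sub>v n $ i" using i by (simp add: complex_eq_iff)
      qed (use v in auto)
      with v show False by simp
    qed
    then show "q (M *\<^sub>v a) + q (M *\<^sub>v b) < q a + q b" "q a + q b > 0"
      using pos_def_matD(2)[OF P(2,1) a] pos_def_matD(2)[OF P(2,1) b] decr[OF a] decr[OF b] q0 unfolding q_def[symmetric]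
      by (cases "a = 0\<^sub>v n"; cases "b = 0\<^sub>v n"; force)+
  qed
  ultimately have "(Re z)\<^sup>2 + (Im z)\<^sup>2 < 1"
    by (metis mult_less_cancel_right_pos mult_1)
  then show "cmod z < 1" unfolding cmod_def by simp
qed

lemma trajectory_carrier:
  assumes "M \<in> carrier_mat n n" "x0 \<in> carrier_vec n"
  shows "trajectory M x0 t \<in> carrier_vec n"
  using assms by (induction t) auto

lemma trajectory_Suc_shift: "trajectory M x0 (Suc t) = trajectory M (M *\<^sub>v x0) t"
  by (induction t) auto

text \<open>A telescoping estimate: the cost paid up to time \<open>k\<close> plus the form of
  \<open>P\<close> at the current state never exceeds the form at \<open>x0\<close>. Dropping the
  nonnegative current term bounds every partial sum.\<close>

lemma lyapunov_cost_le:
  fixes M P :: "real mat" and f :: "real vec \<Rightarrow> real"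
  assumes M: "M \<in> carrier_mat n n" and x0: "x0 \<in> carrier_vec n"
    and f: "\<And>v. f v \<ge> 0"
    and nonneg: "\<And>v. v \<in> carrier_vec n \<Longrightarrow> v \<bullet> (P *\<^sub>v v) \<ge> 0"
    and decr: "\<And>v. v \<in> carrier_vec n \<Longrightarrow>
      (M *\<^sub>v v) \<bullet> (P *\<^sub>v (M *\<^sub>v v)) + f v \<le> v \<bullet> (P *\<^sub>v v)"
  shows "(\<Sum>t. ereal (f (trajectory M x0 t))) \<le> ereal (x0 \<bullet> (P *\<^sub>v x0))"
proof (rule suminf_bound, rule allI)
  fix k
  let ?x = "trajectory M x0"
  have "(\<Sum>t<k. f (?x t)) + ?x k \<bullet> (P *\<^sub>v ?x k) \<le> x0 \<bullet> (P *\<^sub>v x0)"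
  proof (induction k)
    case (Suc k)
    then show ?case using decr[OF trajectory_carrier[OF M x0, of k]] by simp
  qed simp
  moreover have "?x k \<bullet> (P *\<^sub>v ?x k) \<ge> 0" by (rule nonneg[OF trajectory_carrier[OF M x0]])
  ultimately show "(\<Sum>t<k. ereal (f (?x t))) \<le> ereal (x0 \<bullet> (P *\<^sub>v x0))" by simp
qed (simp add: f)

section \<open>Strict Lyapunov solutions for a stable matrix\<close>

lemma pow_mat_smult:
  fixes A :: "'a :: comm_ring_1 mat"
  assumes "A \<in> carrier_mat n n"
  shows "(a \<cdot>\<^sub>m A) ^\<^sub>m k = a ^ k \<cdot>\<^sub>m (A ^\<^sub>m k)"
proof (induction k)
  case 0
  show ?case using assms by auto
next
  case (Suc k)
  have Ak: "A ^\<^sub>m k \<in> carrier_mat n n" using assms by simp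
  have "(a \<cdot>\<^sub>m A) ^\<^sub>m Suc k = a \<cdot>\<^sub>m (a ^ k \<cdot>\<^sub>m (A ^\<^sub>m k * A))"
    using assms Ak Suc by (simp add: mult_smult_distrib[of _ n n] mult_smult_assoc_mat[of _ n n])
  also have "\<dots> = a ^ Suc k \<cdot>\<^sub>m (A ^\<^sub>m Suc k)"
    by (intro eq_matI) (auto simp: mult_ac)
  finally show ?case .
qed

lemma trajectory_eq_pow_mat:
  assumes M: "M \<in> carrier_mat n n" and x0: "x0 \<in> carrier_vec n"
  shows "trajectory M x0 t = (M ^\<^sub>m t) *\<^sub>v x0"
  using x0
proof (induction t arbitrary: x0)
  case 0
  then show ?case using M by simp
next
  case (Suc t)
  then show ?case
    using assoc_mult_mat_vec[OF pow_carrier_mat[OF M] M Suc.prems, of t] M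
    by (simp add: trajectory_Suc_shift del: trajectory.simps)
qed

text \<open>For \<open>r\<close> strictly between the spectral radius and 1, the powers of \<open>M / r\<close> are bounded.\<close>

lemma stable_mat_pow_bound:
  fixes M :: "real mat"
  assumes M: "M \<in> carrier_mat n n" and st: "stable_mat M"
  shows "\<exists>c r. 0 < r \<and> r < 1 \<and> (\<forall>k. \<forall>i<n. \<forall>j<n. \<bar>(M ^\<^sub>m k) $$ (i, j)\<bar> \<le> c * r ^ k)"
\<comment> \<open>In dimension 0 the spectrum is empty and the bound is vacuous; the spectral radius
  is used only for positive dimension.\<close>
proof (cases "n = 0")
  case True
  then show ?thesis by (intro exI[of _ 0] exI[of _ "1/2"]) auto
next
  case False
  then have n: "n > 0" by simp
  define A where "A = map_mat complex_of_real M"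
  have A: "A \<in> carrier_mat n n" unfolding A_def using M by simp
  have ev: "cmod z < 1" if "eigenvalue A z" for z
    using st that unfolding stable_mat_def A_def by blast
  define s where "s = spectral_radius A"
  have s: "0 \<le> s" "s < 1"
    using spectral_radius_mem_max(1)[OF A n] ev unfolding s_def spectrum_def by auto
  define r where "r = (s + 1) / 2"
  have r: "0 < r" "r < 1" "s < r" unfolding r_def using s by auto
  define B where "B = complex_of_real (1 / r) \<cdot>\<^sub>m A"
  have B: "B \<in> carrier_mat n n" unfolding B_def using A by simp
  \<comment> \<open>An eigenvalue \<open>z\<close> of \<open>B\<close> gives the eigenvalue
    \<open>r * z\<close> of \<open>A\<close>, whose modulus is at most \<open>s < r\<close>.\<close>
  have "cmod z < 1" if z: "eigenvalue B z" for z
  proof -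
    obtain v where v: "v \<in> carrier_vec n" "v \<noteq> 0\<^sub>v n" and Bv: "B *\<^sub>v v = z \<cdot>\<^sub>v v"
      using z B unfolding eigenvalue_def eigenvector_def by auto
    have "A = complex_of_real r \<cdot>\<^sub>m B"
      unfolding B_def using A r by (intro eq_matI) auto
    then have "A *\<^sub>v v = complex_of_real r \<cdot>\<^sub>v (B *\<^sub>v v)"
      using B v by (intro eq_vecI) auto
    then have "A *\<^sub>v v = (complex_of_real r * z) \<cdot>\<^sub>v v"
      unfolding Bv by (simp add: smult_smult_assoc)
    then have "eigenvalue A (complex_of_real r * z)"
      unfolding eigenvalue_def eigenvector_def using v A by auto
    then have "cmod (complex_of_real r * z) \<le> s"
      unfolding s_def by (intro spectral_radius_mem_max(2)[OF A n]) (auto simp: spectrum_def)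
    then have "r * cmod z \<le> s" using r by (simp add: norm_mult)
    then have "r * cmod z < r * 1" using r by linarith
    then show ?thesis using r by (simp only: mult_less_cancel_left_pos)
  qed
  then have "spectral_radius B < 1"
    using spectral_radius_mem_max(1)[OF B n] unfolding spectrum_def by auto
  \<comment> \<open>Spectral radius below 1 yields one bound \<open>c\<close> on the entries of all
    powers of \<open>B\<close>; undoing the scaling by \<open>1 / r\<close> produces the factor
    \<open>r ^ k\<close>.\<close>
  then obtain c where c: "\<And>k. norm_bound (B ^\<^sub>m k) c"
    using spectral_radius_jnf_norm_bound_less_1_upper_triangular[OF B] by blast
  have "\<bar>(M ^\<^sub>m k) $$ (i, j)\<bar> \<le> c * r ^ k" if ij: "i < n" "j < n" for k i j
  proof -
    have Mk: "M ^\<^sub>m k \<in> carrier_mat n n" using M by simp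
    have "A ^\<^sub>m k = map_mat complex_of_real (M ^\<^sub>m k)"
      unfolding A_def of_real_hom.mat_hom_pow[OF M] ..
    then have "B ^\<^sub>m k = complex_of_real (1 / r) ^ k \<cdot>\<^sub>m map_mat complex_of_real (M ^\<^sub>m k)"
      unfolding B_def pow_mat_smult[OF A] by simp
    then have "cmod ((B ^\<^sub>m k) $$ (i, j)) = (1 / r) ^ k * \<bar>(M ^\<^sub>m k) $$ (i, j)\<bar>"
      using ij M Mk r by (simp add: norm_mult norm_power norm_divide)
    moreover have "cmod ((B ^\<^sub>m k) $$ (i, j)) \<le> c"
      using c[of k] ij B unfolding norm_bound_def by simp
    ultimately have "\<bar>(M ^\<^sub>m k) $$ (i, j)\<bar> / r ^ k \<le> c"
      by (simp add: power_one_over)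
    then show ?thesis using r by (simp add: pos_divide_le_eq)
  qed
  then show ?thesis using r by blast
qed

text \<open>\<open>P\<close> is the entrywise sum of the matrices \<open>G k\<close>, whose form at
  \<open>v\<close> is the form of \<open>S\<close> at time \<open>k\<close> of the trajectory from
  \<open>v\<close>. Each entry of \<open>G k\<close> is a finite sum of terms with two entries of
  \<open>M ^\<^sub>m k\<close> as factors, so it decays like \<open>(r\<^sup>2) ^ k\<close>.\<close>

lemma lyapunov_series:
  fixes M S :: "real mat"
  assumes M: "M \<in> carrier_mat n n" and st: "stable_mat M"
    and S: "S \<in> carrier_mat n n" "transpose_mat S = S"
  shows "\<exists>P \<in> carrier_mat n n. transpose_mat P = P \<and> (\<forall>v \<in> carrier_vec n.
    (\<lambda>k. trajectory M v k \<bullet> (S *\<^sub>v trajectory M v k)) sums (v \<bullet> (P *\<^sub>v v)))"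
proof -
  define G where "G k = transpose_mat (M ^\<^sub>m k) * (S * M ^\<^sub>m k)" for k
  have Mk: "M ^\<^sub>m k \<in> carrier_mat n n" for k using M by simp
  have SMk: "S * M ^\<^sub>m k \<in> carrier_mat n n" for k using S Mk by simp
  have G: "G k \<in> carrier_mat n n" for k unfolding G_def using Mk[of k] SMk[of k] by simp
  obtain c r where r: "0 < r" "r < 1"
    and bound: "\<And>k i j. i < n \<Longrightarrow> j < n \<Longrightarrow> \<bar>(M ^\<^sub>m k) $$ (i, j)\<bar> \<le> c * r ^ k"
    using stable_mat_pow_bound[OF M st] by blast
  have G_entry: "G k $$ (i, j) =
      (\<Sum>a<n. \<Sum>b<n. (M ^\<^sub>m k) $$ (a, i) * (S $$ (a, b) * (M ^\<^sub>m k) $$ (b, j)))"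
    if "i < n" "j < n" for k i j
    using that M Mk[of k] S SMk[of k] unfolding G_def
    by (simp add: scalar_prod_def atLeast0LessThan sum_distrib_left)
  have summ: "summable (\<lambda>k. G k $$ (i, j))" if ij: "i < n" "j < n" for i j
  proof -
    have "summable (\<lambda>k. (M ^\<^sub>m k) $$ (a, i) * (S $$ (a, b) * (M ^\<^sub>m k) $$ (b, j)))"
      if ab: "a < n" "b < n" for a b
    proof (rule summable_comparison_test)
      have "norm ((M ^\<^sub>m k) $$ (a, i) * (S $$ (a, b) * (M ^\<^sub>m k) $$ (b, j)))
          \<le> c\<^sup>2 * \<bar>S $$ (a, b)\<bar> * (r\<^sup>2) ^ k" for k
      proof -
        have "\<bar>(M ^\<^sub>m k) $$ (a, i)\<bar> * \<bar>(M ^\<^sub>m k) $$ (b, j)\<bar> \<le> (c * r ^ k) * (c * r ^ k)"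
          using bound[OF ab(1) ij(1), of k] bound[OF ab(2) ij(2), of k] by (intro mult_mono) auto
        then have "\<bar>S $$ (a, b)\<bar> * (\<bar>(M ^\<^sub>m k) $$ (a, i)\<bar> * \<bar>(M ^\<^sub>m k) $$ (b, j)\<bar>)
            \<le> \<bar>S $$ (a, b)\<bar> * ((c * r ^ k) * (c * r ^ k))"
          by (intro mult_left_mono) auto
        then show ?thesis
          by (simp add: abs_mult power2_eq_square power_mult_distrib mult_ac)
      qed
      then show "\<exists>K. \<forall>k\<ge>K. norm ((M ^\<^sub>m k) $$ (a, i) * (S $$ (a, b) * (M ^\<^sub>m k) $$ (b, j)))
          \<le> c\<^sup>2 * \<bar>S $$ (a, b)\<bar> * (r\<^sup>2) ^ k" by blast
      show "summable (\<lambda>k. c\<^sup>2 * \<bar>S $$ (a, b)\<bar> * (r\<^sup>2) ^ k)"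
        using r by (intro summable_mult summable_geometric) (simp add: power_less_one_iff)
    qed
    then show ?thesis unfolding G_entry[OF ij] by (intro summable_sum) auto
  qed
  define P where "P = mat n n (\<lambda>(i, j). \<Sum>k. G k $$ (i, j))"
  have P: "P \<in> carrier_mat n n" unfolding P_def by simp
  have G_sums: "(\<lambda>k. G k $$ (i, j)) sums P $$ (i, j)" if "i < n" "j < n" for i j
    using summable_sums[OF summ[OF that]] that unfolding P_def by simp
  have "transpose_mat (G k) = G k" for k
  proof -
    have "transpose_mat (G k) = transpose_mat (S * M ^\<^sub>m k) * M ^\<^sub>m k"
      unfolding G_def using transpose_mult[of "transpose_mat (M ^\<^sub>m k)" n n _ n] Mk[of k] SMk[of k]
      by simp
    then show ?thesis
      unfolding G_def using transpose_mult[OF S(1) Mk[of k]] S Mk[of k]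
      by (simp add: assoc_mult_mat[of _ n n _ n _ n])
  qed
  then have "G k $$ (j, i) = G k $$ (i, j)" if "i < n" "j < n" for i j k
    using that G[of k] by (metis carrier_matD index_transpose_mat(1))
  then have Pt: "transpose_mat P = P" unfolding P_def by (intro eq_matI) auto
  have quad: "v \<bullet> (A *\<^sub>v v) = (\<Sum>i<n. v $ i * (\<Sum>j<n. A $$ (i, j) * v $ j))"
    if "A \<in> carrier_mat n n" "v \<in> carrier_vec n" for A v
    using that by (auto simp: scalar_prod_def atLeast0LessThan intro!: sum.cong)
  have "(\<lambda>k. trajectory M v k \<bullet> (S *\<^sub>v trajectory M v k)) sums (v \<bullet> (P *\<^sub>v v))"
    if v: "v \<in> carrier_vec n" for v
  proof -
    have "trajectory M v k \<bullet> (S *\<^sub>v trajectory M v k) = v \<bullet> (G k *\<^sub>v v)" for k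
    proof -
      let ?x = "M ^\<^sub>m k *\<^sub>v v"
      have x: "?x \<in> carrier_vec n" using Mk[of k] v by simp
      have Sx: "S *\<^sub>v ?x \<in> carrier_vec n" using S x by simp
      have "G k *\<^sub>v v = transpose_mat (M ^\<^sub>m k) *\<^sub>v (S *\<^sub>v ?x)"
        unfolding G_def using assoc_mult_mat_vec[OF transpose_carrier_mat[THEN iffD2, OF Mk] SMk v] assoc_mult_mat_vec[OF S(1) Mk v] by simp
      moreover have "G k *\<^sub>v v \<in> carrier_vec n" using G[of k] v by simp
      ultimately have "v \<bullet> (G k *\<^sub>v v) = (transpose_mat (M ^\<^sub>m k) *\<^sub>v (S *\<^sub>v ?x)) \<bullet> v"
        using comm_scalar_prod[OF v] by simp
      also have "\<dots> = (S *\<^sub>v ?x) \<bullet> ?x" by (rule transpose_vec_mult_scalar[OF Mk v Sx])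
      finally have "v \<bullet> (G k *\<^sub>v v) = (S *\<^sub>v ?x) \<bullet> ?x" .
      then show ?thesis
        using comm_scalar_prod[OF x Sx] trajectory_eq_pow_mat[OF M v] by simp
    qed
    moreover have "(\<lambda>k. v \<bullet> (G k *\<^sub>v v)) sums (v \<bullet> (P *\<^sub>v v))"
      unfolding quad[OF G v] quad[OF P v]
      by (intro sums_sum sums_mult sums_mult2 G_sums) auto
    ultimately show ?thesis by simp
  qed
  then show ?thesis using P Pt by blast
qed

lemma gram_quadratic_form:
  fixes N :: "real mat"
  assumes N: "N \<in> carrier_mat p n" and v: "v \<in> carrier_vec n"
  shows "v \<bullet> ((transpose_mat N * N) *\<^sub>v v) = (N *\<^sub>v v) \<bullet> (N *\<^sub>v v)"
proof -
  have Nv: "N *\<^sub>v v \<in> carrier_vec p" using N v by simp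
  have "(transpose_mat N * N) *\<^sub>v v = transpose_mat N *\<^sub>v (N *\<^sub>v v)" using N v by simp
  then show ?thesis
    using transpose_vec_mult_scalar[OF N v Nv] N
      comm_scalar_prod[OF v mult_mat_vec_carrier[OF _ Nv], of "transpose_mat N"] by simp
qed

text \<open>\<open>P1\<close> sums the output energy and \<open>P2\<close> the state energy along
  trajectories. \<open>P1\<close> satisfies the Lyapunov relation only with equality; a small
  multiple of \<open>P2\<close> makes it strict and \<open>P\<close> positive definite, while the
  strict cost bound leaves room for this multiple at \<open>x0\<close>.\<close>

lemma lyapunov_exists:
  fixes M N :: "real mat"
  assumes M: "M \<in> carrier_mat n n" and st: "stable_mat M" and N: "N \<in> carrier_mat p n"
    and x0: "x0 \<in> carrier_vec n"
    and cost: "(\<Sum>t. ereal ((N *\<^sub>v trajectory M x0 t) \<bullet> (N *\<^sub>v trajectory M x0 t))) < ereal \<gamma>"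
  shows "\<exists>P \<in> carrier_mat n n. pos_def_mat P \<and>
    (\<forall>v \<in> carrier_vec n. v \<noteq> 0\<^sub>v n \<longrightarrow>
      (M *\<^sub>v v) \<bullet> (P *\<^sub>v (M *\<^sub>v v)) + (N *\<^sub>v v) \<bullet> (N *\<^sub>v v) < v \<bullet> (P *\<^sub>v v)) \<and>
    x0 \<bullet> (P *\<^sub>v x0) < \<gamma>"
proof -
  have S: "transpose_mat N * N \<in> carrier_mat n n" "transpose_mat (transpose_mat N * N) = transpose_mat N * N"
    using N transpose_mult[of "transpose_mat N" n p N n] by auto
  obtain P1 where P1: "P1 \<in> carrier_mat n n" "transpose_mat P1 = P1"
    and q1: "\<And>v. v \<in> carrier_vec n \<Longrightarrow> (\<lambda>k. trajectory M v k \<bullet>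
      ((transpose_mat N * N) *\<^sub>v trajectory M v k)) sums (v \<bullet> (P1 *\<^sub>v v))"
    using lyapunov_series[OF M st S] by blast
  have s1: "(\<lambda>k. (N *\<^sub>v trajectory M v k) \<bullet> (N *\<^sub>v trajectory M v k)) sums (v \<bullet> (P1 *\<^sub>v v))"
    if "v \<in> carrier_vec n" for v
    using q1[OF that] by (simp only: gram_quadratic_form[OF N trajectory_carrier[OF M that]])
  obtain P2 where P2: "P2 \<in> carrier_mat n n" "transpose_mat P2 = P2"
    and q2: "\<And>v. v \<in> carrier_vec n \<Longrightarrow> (\<lambda>k. trajectory M v k \<bullet>
      (1\<^sub>m n *\<^sub>v trajectory M v k)) sums (v \<bullet> (P2 *\<^sub>v v))"
    using lyapunov_series[OF M st one_carrier_mat] by auto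
  have s2: "(\<lambda>k. trajectory M v k \<bullet> trajectory M v k) sums (v \<bullet> (P2 *\<^sub>v v))"
    if "v \<in> carrier_vec n" for v
    using q2[OF that] by (simp only: one_mult_mat_vec[OF trajectory_carrier[OF M that]])
  have step: "f v + l (M *\<^sub>v v) = l v"
    if "\<And>v. v \<in> carrier_vec n \<Longrightarrow> (\<lambda>k. f (trajectory M v k)) sums l v" "v \<in> carrier_vec n"
    for f l :: "real vec \<Rightarrow> real" and v
  proof -
    have "(\<lambda>k. f (trajectory M v (Suc k))) sums l (M *\<^sub>v v)"
      unfolding trajectory_Suc_shift using that M by simp
    then have "(\<lambda>k. f (trajectory M v k)) sums (l (M *\<^sub>v v) + f (trajectory M v 0))"
      by (rule sums_Suc)
    then show ?thesis using that sums_unique2 by fastforce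
  qed
  have step1: "(N *\<^sub>v v) \<bullet> (N *\<^sub>v v) + (M *\<^sub>v v) \<bullet> (P1 *\<^sub>v (M *\<^sub>v v)) = v \<bullet> (P1 *\<^sub>v v)"
    if "v \<in> carrier_vec n" for v
    by (rule step[where f = "\<lambda>x. (N *\<^sub>v x) \<bullet> (N *\<^sub>v x)" and l = "\<lambda>x. x \<bullet> (P1 *\<^sub>v x)", OF s1 that])
  have step2: "v \<bullet> v + (M *\<^sub>v v) \<bullet> (P2 *\<^sub>v (M *\<^sub>v v)) = v \<bullet> (P2 *\<^sub>v v)"
    if "v \<in> carrier_vec n" for v
    by (rule step[where f = "\<lambda>x. x \<bullet> x" and l = "\<lambda>x. x \<bullet> (P2 *\<^sub>v x)", OF s2 that])
  have nonneg1: "v \<bullet> (P1 *\<^sub>v v) \<ge> 0" if "v \<in> carrier_vec n" for v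
    by (rule sums_le[OF _ sums_zero s1[OF that]]) (rule scalar_prod_self_nonneg)
  have nonneg2: "v \<bullet> (P2 *\<^sub>v v) \<ge> 0" if "v \<in> carrier_vec n" for v
    by (rule sums_le[OF _ sums_zero s2[OF that]]) (rule scalar_prod_self_nonneg)
  have pos2: "v \<bullet> (P2 *\<^sub>v v) > 0" if "v \<in> carrier_vec n" "v \<noteq> 0\<^sub>v n" for v
    using step2[OF that(1)] nonneg2[of "M *\<^sub>v v"] scalar_prod_self_pos[OF that] M that by simp
  have "(\<Sum>t. ereal ((N *\<^sub>v trajectory M x0 t) \<bullet> (N *\<^sub>v trajectory M x0 t))) = ereal (x0 \<bullet> (P1 *\<^sub>v x0))"
    using s1[OF x0] by (intro sums_unique[symmetric]) (simp add: sums_ereal)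
  then have gap: "x0 \<bullet> (P1 *\<^sub>v x0) < \<gamma>" using cost by simp
  \<comment> \<open>The added 1 keeps the denominator positive even if the form of \<open>P2\<close>
    vanishes at \<open>x0\<close>, and makes the extra cost strictly smaller than the gap.\<close>
  define \<epsilon> where "\<epsilon> = (\<gamma> - x0 \<bullet> (P1 *\<^sub>v x0)) / (x0 \<bullet> (P2 *\<^sub>v x0) + 1)"
  have \<epsilon>: "\<epsilon> > 0" unfolding \<epsilon>_def using gap nonneg2[OF x0] by simp
  have "\<epsilon> * (x0 \<bullet> (P2 *\<^sub>v x0)) < \<epsilon> * (x0 \<bullet> (P2 *\<^sub>v x0) + 1)" using \<epsilon> by simp
  also have "\<dots> = \<gamma> - x0 \<bullet> (P1 *\<^sub>v x0)" unfolding \<epsilon>_def using nonneg2[OF x0] by simp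
  finally have \<epsilon>_gap: "x0 \<bullet> (P1 *\<^sub>v x0) + \<epsilon> * (x0 \<bullet> (P2 *\<^sub>v x0)) < \<gamma>" by simp
  define P where "P = P1 + \<epsilon> \<cdot>\<^sub>m P2"
  have P: "P \<in> carrier_mat n n" unfolding P_def using P1 P2 by simp
  have Pt: "transpose_mat P = P"
  proof -
    have "transpose_mat (\<epsilon> \<cdot>\<^sub>m P2) = \<epsilon> \<cdot>\<^sub>m transpose_mat P2" by (intro eq_matI) auto
    then show ?thesis
      unfolding P_def using P1 P2 transpose_add[of P1 n n "\<epsilon> \<cdot>\<^sub>m P2"] by simp
  qed
  have PP: "v \<bullet> (P *\<^sub>v v) = v \<bullet> (P1 *\<^sub>v v) + \<epsilon> * (v \<bullet> (P2 *\<^sub>v v))" if v: "v \<in> carrier_vec n" for v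
  proof -
    have "(\<epsilon> \<cdot>\<^sub>m P2) *\<^sub>v v = \<epsilon> \<cdot>\<^sub>v (P2 *\<^sub>v v)" using P2 v by (intro eq_vecI) auto
    then have "P *\<^sub>v v = P1 *\<^sub>v v + \<epsilon> \<cdot>\<^sub>v (P2 *\<^sub>v v)"
      unfolding P_def using add_mult_distrib_mat_vec[OF P1(1) _ v, of "\<epsilon> \<cdot>\<^sub>m P2"] P2 by simp
    then show ?thesis using v P1 P2 by (simp add: scalar_prod_add_distrib[of _ n])
  qed
  have "pos_def_mat P"
    unfolding pos_def_mat_iff[OF P]
    using Pt nonneg1 pos2 \<epsilon> by (simp add: PP add_nonneg_pos)
  moreover have "(M *\<^sub>v v) \<bullet> (P *\<^sub>v (M *\<^sub>v v)) + (N *\<^sub>v v) \<bullet> (N *\<^sub>v v) < v \<bullet> (P *\<^sub>v v)"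
    if v: "v \<in> carrier_vec n" "v \<noteq> 0\<^sub>v n" for v
  proof -
    have Mv: "M *\<^sub>v v \<in> carrier_vec n" using M v by simp
    have "\<epsilon> * (v \<bullet> (P2 *\<^sub>v v)) = \<epsilon> * (v \<bullet> v) + \<epsilon> * ((M *\<^sub>v v) \<bullet> (P2 *\<^sub>v (M *\<^sub>v v)))"
      unfolding step2[OF v(1), symmetric] by (simp add: distrib_left)
    moreover have "\<epsilon> * (v \<bullet> v) > 0" using \<epsilon> scalar_prod_self_pos[OF v] by simp
    ultimately show ?thesis using step1[OF v(1)] unfolding PP[OF v(1)] PP[OF Mv] by linarith
  qed
  moreover have "x0 \<bullet> (P *\<^sub>v x0) < \<gamma>" using \<epsilon>_gap PP[OF x0] by simp
  ultimately show ?thesis using P by blast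
qed

section \<open>Invertibility, and what stabilizing every explaining system forces\<close>

text \<open>A nonzero kernel vector would make the quadratic form vanish, so the determinant is
  nonzero and \<open>mat_inverse\<close> does return a matrix.\<close>

lemma pos_def_mat_inverse:
  fixes Y :: "real mat"
  assumes Y: "Y \<in> carrier_mat n n" and pd: "pos_def_mat Y"
  obtains P where "mat_inverse Y = Some P" "P \<in> carrier_mat n n" "Y * P = 1\<^sub>m n" "P * Y = 1\<^sub>m n"
proof -
  have "det Y \<noteq> 0"
    using pos_def_matD(2)[OF pd Y] unfolding det_0_iff_vec_prod_zero_field[OF Y] by force
  then have "mat_inverse Y \<noteq> None"
    using det_non_zero_imp_unit[OF Y, where b = "()"] mat_inverse(1)[OF Y, where b = "()"] by blast
  then show thesis using mat_inverse(2)[OF Y] that by blast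
qed

text \<open>The row \<open>z\<close> is prescribed and only the column \<open>l\<close> is free:
  this is the shape of the closed-loop changes that a left kernel vector of the data makes
  available. Since \<open>z \<bullet> z > 0\<close>, a suitable \<open>l\<close> sends
  \<open>z\<close> anywhere.\<close>

lemma unstable_rank_one_perturbation:
  fixes M :: "real mat"
  assumes M: "M \<in> carrier_mat n n" and z: "z \<in> carrier_vec n" "z \<noteq> 0\<^sub>v n"
  shows "\<exists>l \<in> carrier_vec n. \<not> stable_mat (M + mat n n (\<lambda>(i, j). l $ i * z $ j))"
proof -
  \<comment> \<open>chosen so that the perturbed matrix maps \<open>z\<close> to \<open>2 z\<close>\<close>
  define l where "l = (1 / (z \<bullet> z)) \<cdot>\<^sub>v (2 \<cdot>\<^sub>v z - M *\<^sub>v z)"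
  define L where "L = mat n n (\<lambda>(i, j). l $ i * z $ j)"
  have l: "l \<in> carrier_vec n" unfolding l_def using M z by simp
  have L: "L \<in> carrier_mat n n" unfolding L_def by simp
  have zz: "z \<bullet> z > 0" by (rule scalar_prod_self_pos[OF z])
  have "L *\<^sub>v z = (z \<bullet> z) \<cdot>\<^sub>v l"
    unfolding L_def using z l
    by (intro eq_vecI) (auto simp: scalar_prod_def sum_distrib_left mult_ac intro!: sum.cong)
  also have "\<dots> = 2 \<cdot>\<^sub>v z - M *\<^sub>v z"
    unfolding l_def using zz by (simp add: smult_smult_assoc)
  finally have "(M + L) *\<^sub>v z = 2 \<cdot>\<^sub>v z"
    unfolding add_mult_distrib_mat_vec[OF M L z(1)] using M z by (intro eq_vecI) auto
  then have "map_mat complex_of_real (M + L) *\<^sub>v map_vec complex_of_real z =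
      map_vec complex_of_real (2 \<cdot>\<^sub>v z)"
    using of_real_hom.mult_mat_vec_hom[OF add_carrier_mat[OF L, of M] z(1)] by metis
  also have "\<dots> = 2 \<cdot>\<^sub>v map_vec complex_of_real z" by (intro eq_vecI) auto
  finally have "map_mat complex_of_real (M + L) *\<^sub>v map_vec complex_of_real z =
      2 \<cdot>\<^sub>v map_vec complex_of_real z" .
  moreover have "map_vec complex_of_real z \<noteq> 0\<^sub>v n"
    using z by (metis of_real_hom.vec_hom_zero_iff)
  ultimately have "eigenvalue (map_mat complex_of_real (M + L)) 2"
    unfolding eigenvalue_def eigenvector_def using z L
    by (intro exI[of _ "map_vec complex_of_real z"]) auto
  then have "\<not> stable_mat (M + L)" unfolding stable_mat_def by force
  then show ?thesis using l unfolding L_def by blast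
qed

text \<open>By duality it suffices that each left kernel vector of the stacked data, split into
  \<open>a\<close> and \<open>b\<close>, also annihilates the identity stacked on \<open>K\<close>.
  Otherwise adding \<open>l\<close> times the rows \<open>a\<close> and \<open>b\<close> to
  \<open>As\<close> and \<open>Bs\<close> preserves the data but changes the closed loop by
  \<open>l\<close> times a nonzero row, which can destroy stability.\<close>

lemma right_inverse_if_stabilizing_all:
  fixes As Bs Xm U K :: "real mat"
  assumes As: "As \<in> carrier_mat n n" and Bs: "Bs \<in> carrier_mat n m"
    and Xm: "Xm \<in> carrier_mat n T" and U: "U \<in> carrier_mat m T" and K: "K \<in> carrier_mat m n"
    and stable: "\<And>A B. A \<in> carrier_mat n n \<Longrightarrow> B \<in> carrier_mat n m \<Longrightarrow>
      A * Xm + B * U = As * Xm + Bs * U \<Longrightarrow> stable_mat (A + B * K)"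
  shows "\<exists>\<Gamma> \<in> carrier_mat T n. Xm * \<Gamma> = 1\<^sub>m n \<and> U * \<Gamma> = K"
proof -
  have one: "(1\<^sub>m n :: real mat) \<in> carrier_mat n n" by simp
  have W: "Xm @\<^sub>r U \<in> carrier_mat (n + m) T" using Xm U by (rule carrier_append_rows)
  have V: "1\<^sub>m n @\<^sub>r K \<in> carrier_mat (n + m) n" using one K by (rule carrier_append_rows)
  have col_W: "col (Xm @\<^sub>r U) t = col Xm t @\<^sub>v col U t" if "t < T" for t
    unfolding append_rows_def
    using col_four_block_mat(1)[OF Xm _ U, of "0\<^sub>m n 0" 0 "0\<^sub>m m 0" t] that Xm U by simp
  have col_V: "col (1\<^sub>m n @\<^sub>r K) j = col (1\<^sub>m n) j @\<^sub>v col K j" if "j < n" for j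
    unfolding append_rows_def
    using col_four_block_mat(1)[OF one _ K, of "0\<^sub>m n 0" 0 "0\<^sub>m m 0" j] that K by simp
  have "\<exists>\<Gamma> \<in> carrier_mat T n. (Xm @\<^sub>r U) * \<Gamma> = 1\<^sub>m n @\<^sub>r K"
  proof (rule factors_through_if_left_kernel_subset[OF W V], rule ccontr)
    fix w j
    assume w: "w \<in> carrier_vec (n + m)" and j: "j < n"
      and ker: "\<And>t. t < T \<Longrightarrow> w \<bullet> col (Xm @\<^sub>r U) t = 0"
      and neq: "w \<bullet> col (1\<^sub>m n @\<^sub>r K) j \<noteq> 0"
    define a where "a = vec_first w n"
    define b where "b = vec_last w m"
    have a: "a \<in> carrier_vec n" and b: "b \<in> carrier_vec m" unfolding a_def b_def by auto
    have w_eq: "w = a @\<^sub>v b" unfolding a_def b_def using w by simp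
    have ker': "a \<bullet> col Xm t + b \<bullet> col U t = 0" if "t < T" for t
      using ker[OF that] scalar_prod_append[OF a b, of "col Xm t" "col U t"] Xm U that
      unfolding w_eq col_W[OF that] by simp
    \<comment> \<open>The row obtained by applying the kernel vector to the identity stacked on
      \<open>K\<close>; its entry \<open>j\<close> is nonzero by \<open>neq\<close>.\<close>
    define z where "z = vec n (\<lambda>j. a \<bullet> col (1\<^sub>m n) j + b \<bullet> col K j)"
    have z: "z \<in> carrier_vec n" unfolding z_def by simp
    have "w \<bullet> col (1\<^sub>m n @\<^sub>r K) j = a \<bullet> col (1\<^sub>m n) j + b \<bullet> col K j"
      unfolding w_eq col_V[OF j] using K j by (intro scalar_prod_append[OF a b]) auto
    then have "z $ j \<noteq> 0" using neq j unfolding z_def by simp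
    then have "z \<noteq> 0\<^sub>v n" using j by auto
    then obtain l where l: "l \<in> carrier_vec n"
      and unstable: "\<not> stable_mat ((As + Bs * K) + mat n n (\<lambda>(i, j). l $ i * z $ j))"
      using unstable_rank_one_perturbation[of "As + Bs * K" n z] As Bs K z by auto
    \<comment> \<open>Every row of \<open>A0\<close> and \<open>B0\<close> is a multiple of
      \<open>a\<close> and \<open>b\<close> with the same factor, so \<open>ker'\<close> gives a
      homogeneous solution for any \<open>l\<close>.\<close>
    define A0 where "A0 = mat n n (\<lambda>(i, j). l $ i * a $ j)"
    define B0 where "B0 = mat n m (\<lambda>(i, j). l $ i * b $ j)"
    have A0: "A0 \<in> carrier_mat n n" and B0: "B0 \<in> carrier_mat n m"
      unfolding A0_def B0_def by auto
    have rows: "row A0 i = l $ i \<cdot>\<^sub>v a" "row B0 i = l $ i \<cdot>\<^sub>v b" if "i < n" for i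
      using that a b unfolding A0_def B0_def by (auto intro!: eq_vecI)
    have "A0 * Xm + B0 * U = 0\<^sub>m n T"
    proof (rule eq_matI)
      fix i t assume "i < dim_row (0\<^sub>m n T :: real mat)" "t < dim_col (0\<^sub>m n T :: real mat)"
      then have it: "i < n" "t < T" by auto
      have "(A0 * Xm + B0 * U) $$ (i, t) = l $ i * (a \<bullet> col Xm t + b \<bullet> col U t)"
        using it A0 B0 Xm U a b rows by (simp add: distrib_left)
      then show "(A0 * Xm + B0 * U) $$ (i, t) = 0\<^sub>m n T $$ (i, t)" using ker'[OF it(2)] it by simp
    qed (use A0 B0 Xm U in auto)
    moreover have "(As + A0) * Xm + (Bs + B0) * U = As * Xm + Bs * U + (A0 * Xm + B0 * U)"
      unfolding add_mult_distrib_mat[OF As A0 Xm] add_mult_distrib_mat[OF Bs B0 U]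
      using As A0 Bs B0 Xm U by (intro eq_matI) auto
    ultimately have "(As + A0) * Xm + (Bs + B0) * U = As * Xm + Bs * U"
      using As Bs Xm U by simp
    then have "stable_mat ((As + A0) + (Bs + B0) * K)"
      using As A0 Bs B0 by (intro stable) auto
    moreover have "(As + A0) + (Bs + B0) * K = (As + Bs * K) + mat n n (\<lambda>(i, j). l $ i * z $ j)"
      unfolding add_mult_distrib_mat[OF Bs B0 K]
    proof (rule eq_matI)
      fix i j
      assume "i < dim_row ((As + Bs * K) + mat n n (\<lambda>(i, j). l $ i * z $ j))"
        "j < dim_col ((As + Bs * K) + mat n n (\<lambda>(i, j). l $ i * z $ j))"
      then have ij: "i < n" "j < n" by auto
      have "a \<bullet> col (1\<^sub>m n) j = a $ j" using a ij by simp
      then have "l $ i * z $ j = A0 $$ (i, j) + (B0 * K) $$ (i, j)"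
        using ij B0 K b rows unfolding z_def A0_def by (simp add: distrib_left)
      then show "(As + A0 + (Bs * K + B0 * K)) $$ (i, j) =
          ((As + Bs * K) + mat n n (\<lambda>(i, j). l $ i * z $ j)) $$ (i, j)"
        using ij As A0 Bs B0 K by simp
    qed (use As A0 Bs B0 K in auto)
    ultimately show False using unstable by simp
  qed
  then obtain \<Gamma> where \<Gamma>: "\<Gamma> \<in> carrier_mat T n" and eq: "(Xm @\<^sub>r U) * \<Gamma> = 1\<^sub>m n @\<^sub>r K" by blast
  have cols: "Xm *\<^sub>v col \<Gamma> j = col (1\<^sub>m n) j \<and> U *\<^sub>v col \<Gamma> j = col K j" if j: "j < n" for j
  proof -
    have g: "col \<Gamma> j \<in> carrier_vec T" using \<Gamma> j by simp
    have "(Xm *\<^sub>v col \<Gamma> j) @\<^sub>v (U *\<^sub>v col \<Gamma> j) = col ((Xm @\<^sub>r U) * \<Gamma>) j"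
      unfolding mat_mult_append[OF Xm U g, symmetric] using W \<Gamma> j by (metis col_mult2)
    also have "\<dots> = col (1\<^sub>m n) j @\<^sub>v col K j" unfolding eq using col_V[OF j] .
    finally show ?thesis
      using append_vec_eq[of "Xm *\<^sub>v col \<Gamma> j" n "col (1\<^sub>m n) j"] Xm g j by simp
  qed
  have "Xm * \<Gamma> = 1\<^sub>m n"
  proof (rule mat_col_eqI)
    fix j assume "j < dim_col (1\<^sub>m n :: real mat)"
    then have j: "j < n" by simp
    show "col (Xm * \<Gamma>) j = col (1\<^sub>m n) j"
      unfolding col_mult2[OF Xm \<Gamma> j] using cols[OF j] by blast
  qed (use Xm \<Gamma> in auto)
  moreover have "U * \<Gamma> = K"
  proof (rule mat_col_eqI)
    fix j assume "j < dim_col K"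
    then have j: "j < n" using K by simp
    show "col (U * \<Gamma>) j = col K j"
      unfolding col_mult2[OF U \<Gamma> j] using cols[OF j] by blast
  qed (use U \<Gamma> K in auto)
  ultimately show ?thesis using \<Gamma> by blast
qed

section \<open>Closed loops, cost and matrix inequalities in terms of the data\<close>

text \<open>Used twice: with the system matrices it yields the closed loop times \<open>Y\<close>,
  with \<open>C\<close> and \<open>D\<close> the output matrix times \<open>Y\<close>. The
  right-hand sides involve only data and \<Theta>.\<close>

lemma closed_loop_mult:
  fixes A :: "'a :: comm_ring_1 mat"
  assumes A: "A \<in> carrier_mat q n" and B: "B \<in> carrier_mat q m"
    and Xm: "Xm \<in> carrier_mat n T" and U: "U \<in> carrier_mat m T" and \<Theta>: "\<Theta> \<in> carrier_mat T r"
    and K: "K \<in> carrier_mat m n" and KX: "K * (Xm * \<Theta>) = U * \<Theta>"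
  shows "(A + B * K) * (Xm * \<Theta>) = (A * Xm + B * U) * \<Theta>"
proof -
  have X\<Theta>: "Xm * \<Theta> \<in> carrier_mat n r" using Xm \<Theta> by simp
  have "(A + B * K) * (Xm * \<Theta>) = A * (Xm * \<Theta>) + B * K * (Xm * \<Theta>)"
    by (rule add_mult_distrib_mat[OF A mult_carrier_mat[OF B K] X\<Theta>])
  also have "B * K * (Xm * \<Theta>) = B * (K * (Xm * \<Theta>))" by (rule assoc_mult_mat[OF B K X\<Theta>])
  also have "A * (Xm * \<Theta>) + B * (K * (Xm * \<Theta>)) = A * (Xm * \<Theta>) + B * (U * \<Theta>)"
    unfolding KX ..
  also have "\<dots> = (A * Xm + B * U) * \<Theta>"
    using assms by (simp add: add_mult_distrib_mat[of _ q T _ _ r])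
  finally show ?thesis .
qed

text \<open>Orthogonality of the columns of \<open>C\<close> and \<open>D\<close> removes the mixed
  term from the squared length of the output.\<close>

lemma lq_cost_eq_output_energy:
  fixes A B C D K :: "real mat"
  assumes A: "A \<in> carrier_mat n n" and B: "B \<in> carrier_mat n m" and K: "K \<in> carrier_mat m n"
    and C: "C \<in> carrier_mat p n" and D: "D \<in> carrier_mat p m"
    and CD: "transpose_mat C * D = 0\<^sub>m n m" and x0: "x0 \<in> carrier_vec n"
  shows "lq_cost (transpose_mat C * C) (transpose_mat D * D) A B x0 K =
    (\<Sum>t. ereal (((C + D * K) *\<^sub>v trajectory (A + B * K) x0 t) \<bullet>
      ((C + D * K) *\<^sub>v trajectory (A + B * K) x0 t)))"
proof -
  have M: "A + B * K \<in> carrier_mat n n" using A B K by simp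
  have "x \<bullet> ((transpose_mat C * C) *\<^sub>v x) + (K *\<^sub>v x) \<bullet> ((transpose_mat D * D) *\<^sub>v (K *\<^sub>v x)) =
      ((C + D * K) *\<^sub>v x) \<bullet> ((C + D * K) *\<^sub>v x)" if x: "x \<in> carrier_vec n" for x
  proof -
    have Kx: "K *\<^sub>v x \<in> carrier_vec m" using K x by simp
    have Cx: "C *\<^sub>v x \<in> carrier_vec p" and Dx: "D *\<^sub>v (K *\<^sub>v x) \<in> carrier_vec p"
      using C D Kx x by auto
    have N: "(C + D * K) *\<^sub>v x = C *\<^sub>v x + D *\<^sub>v (K *\<^sub>v x)"
      using C D K x by (simp add: add_mult_distrib_mat_vec[of _ p n])
    have "transpose_mat C *\<^sub>v (D *\<^sub>v (K *\<^sub>v x)) = (transpose_mat C * D) *\<^sub>v (K *\<^sub>v x)"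
      using C D Kx by simp
    also have "\<dots> = 0\<^sub>v n" unfolding CD using Kx by (intro eq_vecI) auto
    finally have "(D *\<^sub>v (K *\<^sub>v x)) \<bullet> (C *\<^sub>v x) = 0"
      using transpose_vec_mult_scalar[OF C x Dx] x by simp
    then have "(C *\<^sub>v x) \<bullet> (D *\<^sub>v (K *\<^sub>v x)) = 0" using comm_scalar_prod[OF Cx Dx] by simp
    then show ?thesis
      unfolding N gram_quadratic_form[OF C x] gram_quadratic_form[OF D Kx]
      using quadratic_form_add[of "1\<^sub>m p" p, OF _ _ Cx Dx] Cx Dx by simp
  qed
  then show ?thesis
    unfolding lq_cost_def Let_def using trajectory_carrier[OF M x0] by simp
qed

text \<open>Provides a member of the set of explaining systems, so that a gain good for all of them
  is good for at least one.\<close>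

lemma explaining_systems_true_system:
  fixes As Bs U X :: "real mat"
  assumes "As \<in> carrier_mat n n" "Bs \<in> carrier_mat n m"
    and U: "U \<in> carrier_mat m T" and X: "X \<in> carrier_mat n (T + 1)"
    and sys: "\<And>t. t < T \<Longrightarrow> col X (t + 1) = As *\<^sub>v col X t + Bs *\<^sub>v col U t"
  shows "(As, Bs) \<in> explaining_systems U X"
proof -
  have Xm: "minus_part X \<in> carrier_mat n T" using X unfolding minus_part_def by simp
  have "plus_part X = As * minus_part X + Bs * U"
  proof (rule mat_col_eqI)
    fix t assume "t < dim_col (As * minus_part X + Bs * U)"
    then have t: "t < T" using U by simp
    have "col (plus_part X) t = col X (t + 1)" "col (minus_part X) t = col X t"
      using X t unfolding plus_part_def minus_part_def by (auto intro!: eq_vecI)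
    moreover have "col (As * minus_part X + Bs * U) t = col (As * minus_part X) t + col (Bs * U) t"
      using assms Xm t by (intro eq_vecI) auto
    ultimately show "col (plus_part X) t = col (As * minus_part X + Bs * U) t"
      using sys[OF t] col_mult2[OF assms(1) Xm t] col_mult2[OF assms(2) U t] by simp
  qed (use assms in \<open>auto simp: plus_part_def\<close>)
  then show ?thesis unfolding explaining_systems_def using assms by auto
qed

text \<open>The left side mentions neither \<open>A\<close>, \<open>B\<close> nor \<open>K\<close>:
  the relations \<open>minus_part X * \<Theta> = Y\<close> and \<open>K * Y = U * \<Theta>\<close>
  tie it to the closed loop of any explaining system. One \<open>P\<close> is therefore a
  certificate for all of them.\<close>

lemma lqr_lmi_iff_lyapunov:
  fixes U X C D Y P K \<Theta> :: "real mat"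
  assumes U: "U \<in> carrier_mat m T" and X: "X \<in> carrier_mat n (T + 1)"
    and C: "C \<in> carrier_mat p n" and D: "D \<in> carrier_mat p m"
    and AB: "(A, B) \<in> explaining_systems U X"
    and K: "K \<in> carrier_mat m n" and x0: "x0 \<in> carrier_vec n"
    and Y: "Y \<in> carrier_mat n n" "pos_def_mat Y"
    and P: "P \<in> carrier_mat n n" "Y * P = 1\<^sub>m n" "P * Y = 1\<^sub>m n"
    and \<Theta>: "\<Theta> \<in> carrier_mat T n" "minus_part X * \<Theta> = Y" and KY: "K * Y = U * \<Theta>"
  shows "lqr_lmi U X C D x0 \<gamma> Y \<Theta> \<longleftrightarrow>
    (\<forall>v \<in> carrier_vec n. v \<noteq> 0\<^sub>v n \<longrightarrow>
      ((A + B * K) *\<^sub>v v) \<bullet> (P *\<^sub>v ((A + B * K) *\<^sub>v v)) +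
      ((C + D * K) *\<^sub>v v) \<bullet> ((C + D * K) *\<^sub>v v) < v \<bullet> (P *\<^sub>v v)) \<and>
    x0 \<bullet> (P *\<^sub>v x0) < \<gamma>"
proof -
  let ?Xm = "minus_part X" and ?Xp = "plus_part X"
  have A: "A \<in> carrier_mat n n" and B: "B \<in> carrier_mat n m" and Xp: "?Xp = A * ?Xm + B * U"
    using AB U X unfolding explaining_systems_def by auto
  have Xm_c: "?Xm \<in> carrier_mat n T" and Xp_c: "?Xp \<in> carrier_mat n T"
    using X unfolding minus_part_def plus_part_def by auto
  have Zm_c: "C * ?Xm + D * U \<in> carrier_mat p T" using C D Xm_c U by simp
  have M: "A + B * K \<in> carrier_mat n n" and N: "C + D * K \<in> carrier_mat p n"
    using A B C D K by auto
  have KX: "K * (?Xm * \<Theta>) = U * \<Theta>" using KY \<Theta>(2) by simp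
  have MY: "?Xp * \<Theta> = (A + B * K) * Y"
    unfolding Xp using closed_loop_mult[OF A B Xm_c U \<Theta>(1) K KX] \<Theta>(2) by simp
  have NY: "(C * ?Xm + D * U) * \<Theta> = (C + D * K) * Y"
    using closed_loop_mult[OF C D Xm_c U \<Theta>(1) K KX] \<Theta>(2) by simp
  have dims: "dim_row X = n" "dim_col U = T" "dim_row C = p" using X U C by auto
  show ?thesis
    unfolding lqr_lmi_def Let_def dims
      transpose_mult[OF Xp_c \<Theta>(1), symmetric] transpose_mult[OF Zm_c \<Theta>(1), symmetric] MY NY
      pos_def_block3_iff_lyapunov[OF Y P M N] pos_def_bordered_iff[OF Y P x0]
    using Y pos_def_matD(1)[OF Y(2,1)] \<Theta> by simp
qed

text \<open>\<open>Y\<close> is a diagonal block, so test vectors vanishing on the other blocks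
  suffice. This justifies inverting \<open>Y\<close>.\<close>

lemma lqr_lmi_imp_pos_def:
  assumes U: "U \<in> carrier_mat m T" and X: "X \<in> carrier_mat n (T + 1)"
    and C: "C \<in> carrier_mat p n" and D: "D \<in> carrier_mat p m"
    and lmi: "lqr_lmi U X C D x0 \<gamma> Y \<Theta>"
  shows "pos_def_mat Y"
proof -
  have Xm: "minus_part X \<in> carrier_mat n T" and Xp: "plus_part X \<in> carrier_mat n T"
    using X unfolding minus_part_def plus_part_def by auto
  have Zm: "C * minus_part X + D * U \<in> carrier_mat p T" using C D Xm U by simp
  have dims: "dim_row X = n" "dim_col U = T" "dim_row C = p" using X U C by auto
  note lmi' = lmi[unfolded lqr_lmi_def Let_def dims]
  have Y: "Y \<in> carrier_mat n n" "transpose_mat Y = Y" and \<Theta>: "\<Theta> \<in> carrier_mat T n"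
    using lmi' by auto
  have G: "plus_part X * \<Theta> \<in> carrier_mat n n"
    and H: "(C * minus_part X + D * U) * \<Theta> \<in> carrier_mat p n"
    using Xp Zm \<Theta> by auto
  note block = lmi'[unfolded transpose_mult[OF Xp \<Theta>, symmetric] transpose_mult[OF Zm \<Theta>, symmetric]
      pos_def_block3_iff[OF Y G H]]
  show ?thesis
    unfolding pos_def_mat_iff[OF Y(1)]
  proof (intro conjI ballI impI)
    show "transpose_mat Y = Y" by (rule Y(2))
    fix v :: "real vec" assume v: "v \<in> carrier_vec n" "v \<noteq> 0\<^sub>v n"
    have "v \<bullet> (Y *\<^sub>v v) + 2 * (0\<^sub>v n \<bullet> ((plus_part X * \<Theta>) *\<^sub>v v) +
        0\<^sub>v p \<bullet> (((C * minus_part X + D * U) * \<Theta>) *\<^sub>v v)) +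
        (0\<^sub>v n \<bullet> (Y *\<^sub>v 0\<^sub>v n) + 0\<^sub>v p \<bullet> 0\<^sub>v p) > 0"
      using block v zero_carrier_vec by blast
    then show "v \<bullet> (Y *\<^sub>v v) > 0"
      unfolding scalar_prod_left_zero[OF mult_mat_vec_carrier[OF G v(1)]]
        scalar_prod_left_zero[OF mult_mat_vec_carrier[OF H v(1)]]
        scalar_prod_left_zero[OF mult_mat_vec_carrier[OF Y(1) zero_carrier_vec]]
        scalar_prod_left_zero[OF zero_carrier_vec] by simp
  qed
qed

section \<open>Sufficiency, necessity and the theorem\<close>

text \<open>The form of the inverse of \<open>Y\<close> is a Lyapunov function for the closed loop.
  Its decrease gives stability and bounds the cost by its value at \<open>x0\<close>, which the
  bordered inequality keeps below \<gamma>.\<close>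

lemma suboptimal_gain_if_lqr_lmi:
  fixes U X C D Y \<Theta> :: "real mat"
  assumes U: "U \<in> carrier_mat m T" and X: "X \<in> carrier_mat n (T + 1)"
    and C: "C \<in> carrier_mat p n" and D: "D \<in> carrier_mat p m"
    and CD: "transpose_mat C * D = 0\<^sub>m n m" and x0: "x0 \<in> carrier_vec n"
    and AB: "(A, B) \<in> explaining_systems U X"
    and lmi: "lqr_lmi U X C D x0 \<gamma> Y \<Theta>"
  shows "suboptimal_gain (transpose_mat C * C) (transpose_mat D * D) x0 \<gamma> A B
    (U * \<Theta> * the (mat_inverse Y))"
proof -
  have A: "A \<in> carrier_mat n n" and B: "B \<in> carrier_mat n m"
    using AB U X unfolding explaining_systems_def by auto
  have Y: "Y \<in> carrier_mat n n" and \<Theta>: "\<Theta> \<in> carrier_mat T n" "minus_part X * \<Theta> = Y"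
    using lmi U X unfolding lqr_lmi_def Let_def by auto
  have Y_pd: "pos_def_mat Y" by (rule lqr_lmi_imp_pos_def[OF U X C D lmi])
  obtain P where inv: "mat_inverse Y = Some P" and P: "P \<in> carrier_mat n n" "Y * P = 1\<^sub>m n" "P * Y = 1\<^sub>m n"
    using pos_def_mat_inverse[OF Y Y_pd] by blast
  have P_pd: "pos_def_mat P" by (rule pos_def_inverse[OF Y Y_pd P(1,2)])
  define K where "K = U * \<Theta> * P"
  have K: "K \<in> carrier_mat m n" unfolding K_def using U \<Theta> P by simp
  have "K * Y = U * \<Theta> * (P * Y)"
    unfolding K_def using assoc_mult_mat[OF mult_carrier_mat[OF U \<Theta>(1)] P(1) Y] .
  then have KY: "K * Y = U * \<Theta>" unfolding P(3) using U \<Theta> by simp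
  let ?M = "A + B * K" and ?N = "C + D * K"
  have M: "?M \<in> carrier_mat n n" using A B K by simp
  note lyap = lmi[unfolded lqr_lmi_iff_lyapunov[OF U X C D AB K x0 Y Y_pd P \<Theta> KY]]
  have decr: "(?M *\<^sub>v v) \<bullet> (P *\<^sub>v (?M *\<^sub>v v)) + (?N *\<^sub>v v) \<bullet> (?N *\<^sub>v v) < v \<bullet> (P *\<^sub>v v)"
    if "v \<in> carrier_vec n" "v \<noteq> 0\<^sub>v n" for v
    using lyap that by blast
  have "stable_mat ?M"
  proof (rule lyapunov_imp_stable[OF M P(1) P_pd])
    fix v :: "real vec" assume "v \<in> carrier_vec n" "v \<noteq> 0\<^sub>v n"
    then show "(?M *\<^sub>v v) \<bullet> (P *\<^sub>v (?M *\<^sub>v v)) < v \<bullet> (P *\<^sub>v v)"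
      using decr[of v] scalar_prod_self_nonneg[of "?N *\<^sub>v v"] by linarith
  qed
  moreover have "(\<Sum>t. ereal ((?N *\<^sub>v trajectory ?M x0 t) \<bullet> (?N *\<^sub>v trajectory ?M x0 t)))
      \<le> ereal (x0 \<bullet> (P *\<^sub>v x0))"
  proof (rule lyapunov_cost_le[OF M x0])
    fix v :: "real vec" assume v: "v \<in> carrier_vec n"
    have N: "?N \<in> carrier_mat p n" using C D K by simp
    \<comment> \<open>The cost bound asks for the weak decrease at every vector; at 0, where
      \<open>decr\<close> is silent, both sides are 0.\<close>
    have "P *\<^sub>v 0\<^sub>v n = 0\<^sub>v n" "?M *\<^sub>v 0\<^sub>v n = 0\<^sub>v n" "?N *\<^sub>v 0\<^sub>v n = 0\<^sub>v p"
      using mult_mat_zero_vec[OF P(1)] mult_mat_zero_vec[OF M] mult_mat_zero_vec[OF N] by auto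
    then show "(?M *\<^sub>v v) \<bullet> (P *\<^sub>v (?M *\<^sub>v v)) + (?N *\<^sub>v v) \<bullet> (?N *\<^sub>v v) \<le> v \<bullet> (P *\<^sub>v v)"
      using decr[OF v] by (cases "v = 0\<^sub>v n") auto
    show "v \<bullet> (P *\<^sub>v v) \<ge> 0" by (rule pos_def_matD(3)[OF P_pd P(1) v])
  qed (rule scalar_prod_self_nonneg)
  ultimately have "suboptimal_gain (transpose_mat C * C) (transpose_mat D * D) x0 \<gamma> A B K"
    unfolding suboptimal_gain_def lq_cost_eq_output_energy[OF A B K C D CD x0]
    using A B K lyap by (auto intro: le_less_trans)
  then show ?thesis unfolding K_def inv by simp
qed

text \<open>Stability over all explaining systems yields \<Gamma>; the cost bound is then used for
  the single system \<open>As\<close>, \<open>Bs\<close> to obtain a strict Lyapunov matrix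
  \<open>P\<close>, whose inverse serves as \<open>Y\<close>.\<close>

lemma lqr_lmi_if_suboptimal_gain:
  fixes U X C D K :: "real mat"
  assumes U: "U \<in> carrier_mat m T" and X: "X \<in> carrier_mat n (T + 1)"
    and C: "C \<in> carrier_mat p n" and D: "D \<in> carrier_mat p m"
    and CD: "transpose_mat C * D = 0\<^sub>m n m" and x0: "x0 \<in> carrier_vec n"
    and ABs: "(As, Bs) \<in> explaining_systems U X" and K: "K \<in> carrier_mat m n"
    and sub: "\<And>A B. (A, B) \<in> explaining_systems U X \<Longrightarrow>
      suboptimal_gain (transpose_mat C * C) (transpose_mat D * D) x0 \<gamma> A B K"
  shows "\<exists>Y \<Theta>. lqr_lmi U X C D x0 \<gamma> Y \<Theta> \<and> K = U * \<Theta> * the (mat_inverse Y)"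
proof -
  have As: "As \<in> carrier_mat n n" and Bs: "Bs \<in> carrier_mat n m"
    and Xp: "plus_part X = As * minus_part X + Bs * U"
    using ABs U X unfolding explaining_systems_def by auto
  have Xm: "minus_part X \<in> carrier_mat n T" using X unfolding minus_part_def by simp
  have "\<exists>\<Gamma> \<in> carrier_mat T n. minus_part X * \<Gamma> = 1\<^sub>m n \<and> U * \<Gamma> = K"
  proof (rule right_inverse_if_stabilizing_all[OF As Bs Xm U K])
    fix A B assume "A \<in> carrier_mat n n" "B \<in> carrier_mat n m"
      "A * minus_part X + B * U = As * minus_part X + Bs * U"
    then have "(A, B) \<in> explaining_systems U X"
      using U X Xp unfolding explaining_systems_def by auto
    then show "stable_mat (A + B * K)" using sub unfolding suboptimal_gain_def by blast
  qed
  then obtain \<Gamma> where \<Gamma>: "\<Gamma> \<in> carrier_mat T n" "minus_part X * \<Gamma> = 1\<^sub>m n" "U * \<Gamma> = K" by blast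
  let ?M = "As + Bs * K" and ?N = "C + D * K"
  have M: "?M \<in> carrier_mat n n" and N: "?N \<in> carrier_mat p n" using As Bs C D K by auto
  have "stable_mat ?M"
    "(\<Sum>t. ereal ((?N *\<^sub>v trajectory ?M x0 t) \<bullet> (?N *\<^sub>v trajectory ?M x0 t))) < ereal \<gamma>"
    using sub[OF ABs]
    unfolding suboptimal_gain_def lq_cost_eq_output_energy[OF As Bs K C D CD x0] by auto
  then obtain P where P: "P \<in> carrier_mat n n" "pos_def_mat P"
    and lyap: "(\<forall>v \<in> carrier_vec n. v \<noteq> 0\<^sub>v n \<longrightarrow>
      (?M *\<^sub>v v) \<bullet> (P *\<^sub>v (?M *\<^sub>v v)) + (?N *\<^sub>v v) \<bullet> (?N *\<^sub>v v) < v \<bullet> (P *\<^sub>v v)) \<and>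
      x0 \<bullet> (P *\<^sub>v x0) < \<gamma>"
    using lyapunov_exists[OF M _ N x0] by blast
  obtain Y where Y: "Y \<in> carrier_mat n n" and PY: "P * Y = 1\<^sub>m n" and YP: "Y * P = 1\<^sub>m n"
    using pos_def_mat_inverse[OF P] by blast
  have Y_pd: "pos_def_mat Y" by (rule pos_def_inverse[OF P Y PY])
  \<comment> \<open>Scaling the right inverse by \<open>Y\<close> gives
    \<open>minus_part X * \<Theta> = Y\<close> and \<open>U * \<Theta> = K * Y\<close>, so the gain
    recovered from \<Theta> is \<open>K\<close>.\<close>
  define \<Theta> where "\<Theta> = \<Gamma> * Y"
  have \<Theta>: "\<Theta> \<in> carrier_mat T n" unfolding \<Theta>_def using \<Gamma> Y by simp
  have X\<Theta>: "minus_part X * \<Theta> = Y"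
    unfolding \<Theta>_def assoc_mult_mat[OF Xm \<Gamma>(1) Y, symmetric] \<Gamma>(2) using Y by simp
  have U\<Theta>: "U * \<Theta> = K * Y"
    unfolding \<Theta>_def assoc_mult_mat[OF U \<Gamma>(1) Y, symmetric] \<Gamma>(3) ..
  have "lqr_lmi U X C D x0 \<gamma> Y \<Theta>"
    using lyap lqr_lmi_iff_lyapunov[OF U X C D ABs K x0 Y Y_pd P(1) YP PY \<Theta> X\<Theta> U\<Theta>[symmetric]]
    by blast
  moreover have "K = U * \<Theta> * the (mat_inverse Y)"
  proof -
    obtain P' where "mat_inverse Y = Some P'" "P' \<in> carrier_mat n n" "Y * P' = 1\<^sub>m n"
      using pos_def_mat_inverse[OF Y Y_pd] by blast
    then show ?thesis unfolding U\<Theta> using assoc_mult_mat[OF K Y, of P' n] K by simp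
  qed
  ultimately show ?thesis by blast
qed

theorem corollary10:
  fixes n m p T :: nat
    and As Bs U X Q R C D :: "real mat"
    and x0 :: "real vec"
    and \<gamma> :: real
  assumes "As \<in> carrier_mat n n" and "Bs \<in> carrier_mat n m"
    and "U \<in> carrier_mat m T" and "X \<in> carrier_mat n (T + 1)"
    and "\<And>t. t < T \<Longrightarrow> col X (t + 1) = As *\<^sub>v col X t + Bs *\<^sub>v col U t"
    and "Q \<in> carrier_mat n n" and "pos_semidef_mat Q"
    and "R \<in> carrier_mat m m" and "pos_def_mat R"
    and "C \<in> carrier_mat p n" and "D \<in> carrier_mat p m"
    and "Q = transpose_mat C * C" and "R = transpose_mat D * D"
    and "transpose_mat C * D = 0\<^sub>m n m"
    and "x0 \<in> carrier_vec n" and "\<gamma> > 0"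
  shows "(informative_suboptimal_lqr U X Q R x0 \<gamma> \<longleftrightarrow> (\<exists>Y \<Theta>. lqr_lmi U X C D x0 \<gamma> Y \<Theta>)) \<and>
    (\<forall>K \<in> carrier_mat m n.
       (\<forall>(A, B) \<in> explaining_systems U X. suboptimal_gain Q R x0 \<gamma> A B K) \<longleftrightarrow>
       (\<exists>Y \<Theta>. lqr_lmi U X C D x0 \<gamma> Y \<Theta> \<and> K = U * \<Theta> * the (mat_inverse Y)))"
proof -
  note U = assms(3) and X = assms(4) and C = assms(10) and D = assms(11)
    and CD = assms(14) and x0 = assms(15)
  have ABs: "(As, Bs) \<in> explaining_systems U X"
    by (rule explaining_systems_true_system[OF assms(1-5)])
  have gain: "suboptimal_gain Q R x0 \<gamma> A B (U * \<Theta> * the (mat_inverse Y))"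
    if "lqr_lmi U X C D x0 \<gamma> Y \<Theta>" "(A, B) \<in> explaining_systems U X" for Y \<Theta> A B
    unfolding assms(12,13) by (rule suboptimal_gain_if_lqr_lmi[OF U X C D CD x0 that(2,1)])
  have iff: "(\<forall>(A, B) \<in> explaining_systems U X. suboptimal_gain Q R x0 \<gamma> A B K) \<longleftrightarrow>
      (\<exists>Y \<Theta>. lqr_lmi U X C D x0 \<gamma> Y \<Theta> \<and> K = U * \<Theta> * the (mat_inverse Y))"
    if "K \<in> carrier_mat m n" for K
    using lqr_lmi_if_suboptimal_gain[OF U X C D CD x0 ABs that] gain
    unfolding assms(12,13) by blast
  \<comment> \<open>The dimensions are part of \<open>suboptimal_gain\<close>, so they can be read
    off at the true system.\<close>
  have K_carrier: "U * \<Theta> * the (mat_inverse Y) \<in> carrier_mat m n"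
    if "lqr_lmi U X C D x0 \<gamma> Y \<Theta>" for Y \<Theta>
    using gain[OF that ABs] assms(1,2) unfolding suboptimal_gain_def by simp
  have "informative_suboptimal_lqr U X Q R x0 \<gamma> \<longleftrightarrow>
      (\<exists>K \<in> carrier_mat m n. \<forall>(A, B) \<in> explaining_systems U X. suboptimal_gain Q R x0 \<gamma> A B K)"
    unfolding informative_suboptimal_lqr_def using U X by simp
  \<comment> \<open>Informativity follows from the characterization of gains: a good gain supplies a
    solution, and a solution supplies the gain
    \<open>U * \<Theta> * the (mat_inverse Y)\<close>.\<close>
  also have "\<dots> \<longleftrightarrow> (\<exists>Y \<Theta>. lqr_lmi U X C D x0 \<gamma> Y \<Theta>)"
    using iff K_carrier by blast
  finally show ?thesis using iff by blast
qed

end
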